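(* There is an algorithm that, given positive integers $B$ and $k$ and a graph $G=(V,E)$ with $n=|V|$ vertices, $m=|E|$ edges and maximum degree at most $B$, decides whether $G$ has a vertex cover with at most $m/B+k$ vertices in time $O(2^{kB}n^{O(1)})$. In particular, the problem Vertex Cover Above Tight Lower Bound-1 (VCL1), with parameters $k$ and $B$, is fixed-parameter tractable.
   Context: A vertex cover of a graph is a set of vertices containing at least one endpoint of every edge. VCL1: given a positive integer $B$, a graph $G$ with $m$ edges and maximum degree at most $B$, and a positive integer $k$, decide whether $G$ has a vertex cover of at most $m/B+k$ vertices; the parameters are $k$ and $B$. A parameterized problem is fixed-parameter tractable if it can be decided in time $f(\text{parameters})\cdot|I|^{O(1)}$ for a computable $f$. *)

theory Defs
  imports Complex_Main
begin

datatype instr =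
    LoadC nat nat
  | Add nat nat nat
  | Sub nat nat nat
  | LoadI nat nat
  | StoreI nat nat
  | Jz nat nat

type_synonym config = "nat \<times> (nat \<Rightarrow> nat)"

fun exec :: "instr \<Rightarrow> config \<Rightarrow> config" where
  "exec (LoadC r c) (pc, m) = (Suc pc, m(r := c))"
| "exec (Add r a b) (pc, m) = (Suc pc, m(r := m a + m b))"
| "exec (Sub r a b) (pc, m) = (Suc pc, m(r := m a - m b))"
| "exec (LoadI r a) (pc, m) = (Suc pc, m(r := m (m a)))"
| "exec (StoreI a r) (pc, m) = (Suc pc, m(m a := m r))"
| "exec (Jz r l) (pc, m) = (if m r = 0 then (l, m) else (Suc pc, m))"

definition step :: "instr list \<Rightarrow> config \<Rightarrow> config" where
  "step P c = (if fst c < length P then exec (P ! fst c) c else c)"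

definition halted :: "instr list \<Rightarrow> config \<Rightarrow> bool" where
  "halted P c \<longleftrightarrow> length P \<le> fst c"

definition init :: "nat list \<Rightarrow> config" where
  "init xs = (0, \<lambda>i. if i < length xs then xs ! i else 0)"

definition runs_within :: "instr list \<Rightarrow> nat list \<Rightarrow> nat \<Rightarrow> nat \<Rightarrow> bool" where
  "runs_within P xs t out \<longleftrightarrow>
     (\<exists>s\<le>t. halted P ((step P ^^ s) (init xs)) \<and> snd ((step P ^^ s) (init xs)) 0 = out)"

definition simple_graph :: "nat \<Rightarrow> nat set set \<Rightarrow> bool" where
  "simple_graph n E \<longleftrightarrow> (\<forall>e\<in>E. \<exists>u v. e = {u, v} \<and> u \<noteq> v \<and> u < n \<and> v < n)"

definition degree :: "nat set set \<Rightarrow> nat \<Rightarrow> nat" where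
  "degree E v = card {e \<in> E. v \<in> e}"

definition max_degree_le :: "nat \<Rightarrow> nat set set \<Rightarrow> nat \<Rightarrow> bool" where
  "max_degree_le n E B \<longleftrightarrow> (\<forall>v<n. degree E v \<le> B)"

definition vertex_cover :: "nat \<Rightarrow> nat set set \<Rightarrow> nat set \<Rightarrow> bool" where
  "vertex_cover n E C \<longleftrightarrow> C \<subseteq> {..<n} \<and> (\<forall>e\<in>E. e \<inter> C \<noteq> {})"

definition edge_list_of :: "(nat \<times> nat) list \<Rightarrow> nat set set \<Rightarrow> bool" where
  "edge_list_of es E \<longleftrightarrow>
     distinct (map (\<lambda>(u, v). {u, v}) es) \<and> set (map (\<lambda>(u, v). {u, v}) es) = E"

definition encode :: "nat \<Rightarrow> nat \<Rightarrow> nat \<Rightarrow> (nat \<times> nat) list \<Rightarrow> nat list" where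
  "encode B k n es = [B, k, n, length es] @ concat (map (\<lambda>(u, v). [u, v]) es)"

definition VCL1 :: "nat \<Rightarrow> nat \<Rightarrow> nat \<Rightarrow> nat set set \<Rightarrow> bool" where
  "VCL1 B k n E \<longleftrightarrow>
     (\<exists>C. vertex_cover n E C \<and> real (card C) \<le> real (card E) / real B + real k)"

end

theory Submission
  imports Defs
begin

text \<open>Every vertex covers at most \<open>B\<close> edges, so \<open>m/B\<close> is a lower bound already for the linear
  programming relaxation of vertex cover, and it suffices to solve vertex cover above that
  relaxation with excess \<open>k\<close>. Take an uncovered edge. If putting one of its ends into the cover
  lowers the relaxed optimum by 1, this is safe by Nemhauser--Trotter persistency. Otherwise guess
  which end belongs to the cover: either choice costs at least 1/2 of the excess, so \<open>2 k\<close> guessed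
  bits suffice, and all \<open>4 ^ k\<close> strings of guesses are tried. This is at most \<open>2 ^ (k B)\<close> if
  \<open>B \<ge> 2\<close>; if \<open>B = 1\<close> then \<open>m/B\<close> vertices are always enough. The relaxation is solved by an auction
  algorithm for bipartite matching.\<close>

section \<open>Bipartite covers and the half-integral relaxation\<close>

definition bicover :: "('a \<times> 'b) set \<Rightarrow> 'a set \<Rightarrow> 'b set \<Rightarrow> bool" where
  "bicover R X Y \<longleftrightarrow> finite X \<and> finite Y \<and> (\<forall>(u, w)\<in>R. u \<in> X \<or> w \<in> Y)"

definition bicover_number :: "('a \<times> 'b) set \<Rightarrow> nat" where
  "bicover_number R = (LEAST s. \<exists>X Y. bicover R X Y \<and> s = card X + card Y)"

lemma bicover_number_le: "bicover R X Y \<Longrightarrow> bicover_number R \<le> card X + card Y"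
  unfolding bicover_number_def by (rule Least_le) blast

lemma bicover_number_attained:
  assumes "finite R"
  obtains X Y where "bicover R X Y" "bicover_number R = card X + card Y"
proof -
  have "bicover R (Domain R) (Range R)"
    using assms by (auto simp: bicover_def finite_Domain finite_Range)
  then have "\<exists>s X Y. bicover R X Y \<and> s = card X + card Y" by blast
  then have "\<exists>X Y. bicover R X Y \<and> bicover_number R = card X + card Y"
    unfolding bicover_number_def by (rule LeastI_ex)
  then show ?thesis using that by blast
qed

lemma card_le_degree_bicover_number:
  assumes fin: "finite R"
    and out_degree: "\<And>u. card (R `` {u}) \<le> B" and in_degree: "\<And>w. card (R\<inverse> `` {w}) \<le> B"
  shows "card R \<le> B * bicover_number R"
proof -
  obtain X Y where XY: "bicover R X Y" "bicover_number R = card X + card Y"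
    using bicover_number_attained[OF fin] by blast
  then have finXY: "finite X" "finite Y" by (auto simp: bicover_def)
  let ?out = "SIGMA u:X. R `` {u}" and ?inc = "SIGMA w:Y. R\<inverse> `` {w}"
  have fib: "finite (R `` {u})" "finite (R\<inverse> `` {w})" for u w
    using fin by (auto intro: finite_Image)
  have "card ?out = (\<Sum>u\<in>X. card (R `` {u}))" "card ?inc = (\<Sum>w\<in>Y. card (R\<inverse> `` {w}))"
    using finXY fib by (simp_all add: card_SigmaI)
  then have bounds: "card ?out \<le> card X * B" "card ?inc \<le> card Y * B"
    using sum_bounded_above[of X _ B] sum_bounded_above[of Y _ B] out_degree in_degree by auto
  have "R \<subseteq> ?out \<union> prod.swap ` ?inc"
  proof
    fix e assume "e \<in> R"
    moreover obtain u w where "e = (u, w)" by force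
    ultimately show "e \<in> ?out \<union> prod.swap ` ?inc"
      using XY(1) by (force simp: bicover_def)
  qed
  then have "card R \<le> card (?out \<union> prod.swap ` ?inc)"
    using finXY fib by (intro card_mono) auto
  also have "\<dots> \<le> card ?out + card (prod.swap ` ?inc)" by (rule card_Un_le)
  also have "card (prod.swap ` ?inc) \<le> card ?inc"
    using finXY fib by (intro card_image_le) auto
  finally show ?thesis using bounds XY(2) by (simp add: algebra_simps)
qed

definition covers :: "'a rel \<Rightarrow> 'a set \<Rightarrow> bool" where
  "covers A S \<longleftrightarrow> finite S \<and> (\<forall>(u, w)\<in>A. u \<in> S \<or> w \<in> S)"

text \<open>Were the new cover larger than \<open>S\<close>, shifting the half-integral solution by 1/2 along \<open>S\<close>
  would improve it.\<close>

lemma nemhauser_trotter: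
  assumes R: "sym R" and XY: "bicover R X Y" and opt: "card X + card Y \<le> bicover_number R"
    and S: "covers R S"
  shows "covers R ((X \<inter> Y) \<union> (S \<inter> (X \<union> Y)))" "card ((X \<inter> Y) \<union> (S \<inter> (X \<union> Y))) \<le> card S"
proof -
  define P where "P = X \<union> Y"
  define Q where "Q = X \<inter> Y"
  have fin: "finite X" "finite Y" "finite P" "finite Q" "finite S"
    using XY S by (auto simp: P_def Q_def bicover_def covers_def)
  have "Q \<subseteq> P" by (auto simp: P_def Q_def)
  have outside_P: "b \<in> Q" if "(a, b) \<in> R" "a \<notin> P" for a b
    using that XY symD[OF R that(1)] unfolding bicover_def P_def Q_def by fast
  have "bicover R (P \<union> (S - P)) (Q \<inter> S)"
    unfolding bicover_def using outside_P S fin by (auto simp: covers_def)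
  then have "bicover_number R \<le> card (P \<union> (S - P)) + card (Q \<inter> S)"
    by (rule bicover_number_le)
  then have "card P + card Q \<le> card (P \<union> (S - P)) + card (Q \<inter> S)"
    using opt card_Un_Int[OF fin(1,2)] by (simp add: P_def Q_def)
  moreover have "card (P \<union> (S - P)) = card P + card (S - P)"
    using fin by (intro card_Un_disjoint) auto
  moreover have "card Q = card (Q \<inter> S) + card (Q - S)"
    using fin card_Diff_subset_Int[of Q S] card_mono[of Q "Q \<inter> S"] by simp
  ultimately have exchange: "card (Q - S) \<le> card (S - P)" by linarith
  have "Q \<union> (S \<inter> P) = (Q - S) \<union> (S \<inter> P)" using \<open>Q \<subseteq> P\<close> by auto
  then have "card (Q \<union> (S \<inter> P)) \<le> card (Q - S) + card (S \<inter> P)"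
    using card_Un_le[of "Q - S" "S \<inter> P"] by simp
  also have "\<dots> \<le> card (S - P) + card (S \<inter> P)" using exchange by simp
  also have "\<dots> = card S"
    using fin card_Diff_subset_Int[of S P] card_mono[of S "S \<inter> P"] by simp
  finally show "card ((X \<inter> Y) \<union> (S \<inter> (X \<union> Y))) \<le> card S" unfolding P_def Q_def .
  have "a \<in> Q \<union> (S \<inter> P) \<or> b \<in> Q \<union> (S \<inter> P)" if "(a, b) \<in> R" for a b
    using outside_P[OF that] outside_P[OF symD[OF R that]] S that by (auto simp: covers_def)
  then show "covers R ((X \<inter> Y) \<union> (S \<inter> (X \<union> Y)))"
    using fin unfolding covers_def P_def Q_def by auto
qed

text \<open>Twice the optimum of the linear programming relaxation of vertex cover on the graph \<open>A\<close>
  without the vertices \<open>C\<close>: that graph's fractional covers correspond to the covers of its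
  bipartite double.\<close>

definition double_lp :: "'a rel \<Rightarrow> 'a set \<Rightarrow> nat" where
  "double_lp A C = bicover_number (Restr A (- C))"

lemma double_lp_le_cover:
  assumes "covers A S"
  shows "double_lp A C \<le> 2 * card (S - C)"
proof -
  have "bicover (Restr A (- C)) (S - C) (S - C)"
    using assms by (auto simp: bicover_def covers_def)
  from bicover_number_le[OF this] show ?thesis by (simp add: double_lp_def)
qed

lemma bicover_Restr_insert:
  "bicover (Restr A (- insert z C)) X Y \<Longrightarrow> bicover (Restr A (- C)) (insert z X) (insert z Y)"
  by (auto simp: bicover_def)

lemma double_lp_insert:
  assumes "finite A"
  shows "double_lp A C \<le> double_lp A (insert z C) + 2"
proof -
  obtain X Y where XY: "bicover (Restr A (- insert z C)) X Y"
    "double_lp A (insert z C) = card X + card Y"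
    using bicover_number_attained assms unfolding double_lp_def by (metis finite_Int)
  have "double_lp A C \<le> card (insert z X) + card (insert z Y)"
    unfolding double_lp_def using bicover_number_le bicover_Restr_insert[OF XY(1)] .
  also have "\<dots> \<le> Suc (card X) + Suc (card Y)"
    by (intro add_mono card_insert_le_m1) simp_all
  finally show ?thesis using XY(2) by simp
qed

text \<open>Adding \<open>z\<close> to the cover costs nothing: the relaxation drops by at least the one vertex paid.\<close>

definition safe :: "'a rel \<Rightarrow> 'a set \<Rightarrow> 'a \<Rightarrow> bool" where
  "safe A C z \<longleftrightarrow> double_lp A (insert z C) + 2 \<le> double_lp A C"

lemma safe_persistent:
  assumes A: "finite A" "sym A" and S: "covers A S" "C \<subseteq> S" and z: "z \<notin> C" "safe A C z"
  obtains S' where "covers A S'" "insert z C \<subseteq> S'" "card S' \<le> card S"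
proof -
  let ?R = "Restr A (- C)"
  obtain X Y where XY: "bicover (Restr A (- insert z C)) X Y"
    "double_lp A (insert z C) = card X + card Y"
    using bicover_number_attained A(1) unfolding double_lp_def by (metis finite_Int)
  have "card (insert z X) + card (insert z Y) \<le> Suc (card X) + Suc (card Y)"
    by (intro add_mono card_insert_le_m1) simp_all
  then have opt: "card (insert z X) + card (insert z Y) \<le> bicover_number ?R"
    using z(2) XY(2) by (simp add: safe_def double_lp_def)
  have "sym ?R" using A(2) by (auto simp: sym_def)
  moreover have cov: "covers ?R (S - C)" using S(1) by (auto simp: covers_def)
  ultimately obtain T where T: "covers ?R T" "z \<in> T" "card T \<le> card (S - C)"
    using nemhauser_trotter[OF _ bicover_Restr_insert[OF XY(1)] opt] by blast
  have fin: "finite S" "finite C" using S rev_finite_subset[of S C] by (auto simp: covers_def)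
  have "card (C \<union> T) \<le> card C + card (S - C)" using T(3) card_Un_le[of C T] by linarith
  also have "\<dots> = card S" using S(2) fin by (simp add: card_Diff_subset card_mono)
  finally have "card (C \<union> T) \<le> card S" .
  moreover have "covers A (C \<union> T)" using T(1) fin by (auto simp: covers_def)
  ultimately show ?thesis using that T(2) by blast
qed

section \<open>The auction algorithm for bipartite matching\<close>

text \<open>A free left vertex bids for a neighbour of least price \<open>D\<close>, evicting its partner \<open>M\<close>, and
  raises the price by one; it gives up once all its neighbours cost at least \<open>N\<close>.  The left
  vertices in \<open>G\<close> are settled.\<close>

locale auction =
  fixes R :: "('a \<times> 'b) set" and N :: nat and G :: "'a set" and D :: "'b \<Rightarrow> nat" and M :: "'b \<rightharpoonup> 'a"
  assumes unmatched_price: "v \<in> Range R \<Longrightarrow> M v = None \<Longrightarrow> D v = 0"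
    and partner_edge: "M v = Some u \<Longrightarrow> (u, v) \<in> R"
    and partner_settled: "M v = Some u \<Longrightarrow> u \<in> G"
    and partner_unique: "M v = Some u \<Longrightarrow> M v' = Some u \<Longrightarrow> v = v'"
    and near_least_price: "M v = Some u \<Longrightarrow> (u, z) \<in> R \<Longrightarrow> D v \<le> Suc (D z)"
    and settled_cases: "u \<in> G \<Longrightarrow> u \<in> ran M \<or> (\<forall>z. (u, z) \<in> R \<longrightarrow> N \<le> D z)"
begin

lemma dom_subset_Range: "dom M \<subseteq> Range R"
  using partner_edge by blast

lemma card_dom_le_bicover_number:
  assumes "finite R"
  shows "card (dom M) \<le> bicover_number R"
proof -
  obtain X Y where XY: "bicover R X Y" "bicover_number R = card X + card Y"
    using bicover_number_attained[OF assms] by blast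
  then have fin: "finite X" "finite Y" by (auto simp: bicover_def)
  have "inj_on (the \<circ> M) (dom M - Y)"
    using partner_unique by (auto simp: inj_on_def)
  moreover have "(the \<circ> M) ` (dom M - Y) \<subseteq> X"
    using XY(1) partner_edge by (fastforce simp: bicover_def)
  ultimately have "card (dom M - Y) \<le> card X"
    using fin(1) by (intro card_inj_on_le)
  moreover have "card (dom M) \<le> card (dom M - Y) + card Y"
    using diff_card_le_card_Diff[OF fin(2), of "dom M"] by linarith
  ultimately show ?thesis using XY(2) by linarith
qed

lemma bicover_price_gap:
  assumes fin: "finite R" and all_settled: "Domain R \<subseteq> G" and g: "g \<le> N" "g \<notin> D ` Range R"
  shows "bicover R ((the \<circ> M) ` {v \<in> dom M. D v < g}) {v \<in> Range R. g < D v}"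
    (is "bicover R (?partner ` ?below) ?above")
proof -
  have "u \<in> ?partner ` ?below \<or> z \<in> ?above" if uz: "(u, z) \<in> R" for u z
  proof -
    have z: "D z \<noteq> g" using g(2) uz by blast
    consider (matched) v where "M v = Some u" | (hopeless) "N \<le> D z"
      using settled_cases[of u] all_settled uz unfolding ran_def by blast
    then show ?thesis
    proof cases
      case matched
      then have "D v \<noteq> g" using g(2) partner_edge by blast
      then consider "v \<in> ?below" | "g < D z"
        using matched near_least_price[OF matched uz] z by fastforce
      then show ?thesis using matched uz by cases force+
    next
      case hopeless
      then show ?thesis using g(1) z uz by auto
    qed
  qed
  moreover have "finite ?below" "finite ?above"
    using fin finite_subset[OF dom_subset_Range] by (simp_all add: finite_Range)
  ultimately show ?thesis by (auto simp: bicover_def)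
qed

text \<open>One of the \<open>N + 1\<close> prices is not attained.\<close>

lemma bicover_number_le_card_dom:
  assumes fin: "finite R" and all_settled: "Domain R \<subseteq> G" and N: "card (Range R) \<le> N"
  shows "bicover_number R \<le> card (dom M)"
proof -
  have finR: "finite (Range R)" and finM: "finite (dom M)"
    using fin finite_subset[OF dom_subset_Range] by (simp_all add: finite_Range)
  have "card (D ` Range R) < card {..N}"
    using card_image_le[OF finR, of D] N by simp
  then obtain g where g: "g \<le> N" "g \<notin> D ` Range R"
    using card_mono[of "D ` Range R" "{..N}"] finR by fastforce
  define Y where "Y = {v \<in> Range R. g < D v}"
  define Z where "Z = {v \<in> dom M. D v < g}"
  have "v \<in> dom M" if "v \<in> Y" for v
    using that unmatched_price[of v] by (auto simp: Y_def)
  then have sub: "Y \<union> Z \<subseteq> dom M" "Y \<inter> Z = {}" by (auto simp: Y_def Z_def)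
  have finYZ: "finite Y" "finite Z" using finR finM by (simp_all add: Y_def Z_def)
  have "bicover_number R \<le> card ((the \<circ> M) ` Z) + card Y"
    unfolding Y_def Z_def using bicover_number_le bicover_price_gap[OF fin all_settled g] .
  also have "\<dots> \<le> card Z + card Y" using card_image_le[OF finYZ(2)] by simp
  also have "\<dots> = card (Y \<union> Z)" using card_Un_disjoint[OF finYZ sub(2)] by simp
  also have "\<dots> \<le> card (dom M)" using sub(1) finM by (intro card_mono)
  finally show ?thesis .
qed

lemma card_dom_eq_bicover_number:
  assumes "finite R" "Domain R \<subseteq> G" "card (Range R) \<le> N"
  shows "card (dom M) = bicover_number R"
  using card_dom_le_bicover_number bicover_number_le_card_dom assms by (intro antisym)

lemma settle_hopeless:
  assumes "\<And>z. (u, z) \<in> R \<Longrightarrow> N \<le> D z"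
  shows "auction R N (insert u G) D M"
  using unmatched_price partner_edge partner_settled partner_unique near_least_price settled_cases
    assms
  by unfold_locales blast+

lemma settle_by_bid:
  assumes u: "u \<notin> G" "(u, b) \<in> R" and least: "\<And>z. (u, z) \<in> R \<Longrightarrow> D b \<le> D z"
  shows "auction R N (insert u G - set_option (M b)) (D(b := Suc (D b))) (M(b \<mapsto> u))"
proof unfold_locales
  fix v x z assume v: "(M(b \<mapsto> u)) v = Some x"
  show "(x, v) \<in> R" using v u(2) partner_edge by (auto split: if_splits)
  show "x \<in> insert u G - set_option (M b)"
    using v u(1) partner_settled partner_unique by (auto split: if_splits)
  show "v = v'" if "(M(b \<mapsto> u)) v' = Some x" for v'
    using v that u(1) partner_settled partner_unique by (auto split: if_splits)
  assume xz: "(x, z) \<in> R"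
  show "(D(b := Suc (D b))) v \<le> Suc ((D(b := Suc (D b))) z)"
  proof (cases "v = b")
    case True
    then show ?thesis using least[of z] v xz by auto
  next
    case False
    then show ?thesis using near_least_price[of v x z] v xz by auto
  qed
next
  fix x assume x: "x \<in> insert u G - set_option (M b)"
  show "x \<in> ran (M(b \<mapsto> u)) \<or> (\<forall>z. (x, z) \<in> R \<longrightarrow> N \<le> (D(b := Suc (D b))) z)"
  proof (cases "x = u")
    case True
    then show ?thesis by (auto simp: ran_def)
  next
    case False
    then have "x \<in> ran M \<or> (\<forall>z. (x, z) \<in> R \<longrightarrow> N \<le> D z)" using x settled_cases by auto
    then show ?thesis
    proof
      assume "x \<in> ran M"
      then obtain v where "M v = Some x" by (auto simp: ran_def)
      moreover from this have "v \<noteq> b" using x by auto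
      ultimately have "(M(b \<mapsto> u)) v = Some x" by simp
      then show ?thesis by (blast intro: ranI)
    qed (auto intro: le_SucI)
  qed
qed (use unmatched_price in \<open>auto split: if_splits\<close>)

end

lemma auction_init:
  "(\<And>v. v \<in> Range R \<Longrightarrow> D v = 0) \<Longrightarrow> auction R N {} D Map.empty"
  by unfold_locales auto

section \<open>Branching above the relaxation\<close>

definition choose_end :: "'a rel \<Rightarrow> 'a set \<Rightarrow> 'a \<times> 'a \<Rightarrow> (nat \<Rightarrow> bool) \<Rightarrow> 'a \<times> (nat \<Rightarrow> bool)" where
  "choose_end A C = (\<lambda>(u, w) g.
     if safe A C u then (u, g) else if safe A C w then (w, g)
     else (if g 0 then u else w, \<lambda>i. g (Suc i)))"

fun branch_cover :: "'a rel \<Rightarrow> ('a \<times> 'a) list \<Rightarrow> 'a set \<Rightarrow> (nat \<Rightarrow> bool) \<Rightarrow> 'a set" where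
  "branch_cover A [] C g = C"
| "branch_cover A ((u, w) # as) C g =
     (if u \<in> C \<or> w \<in> C then branch_cover A as C g
      else let (z, g') = choose_end A C (u, w) g in branch_cover A as (insert z C) g')"

lemma fst_choose_end: "fst (choose_end A C (u, w) g) \<in> {u, w}"
  by (simp add: choose_end_def)

lemma branch_cover_subset:
  "C \<subseteq> branch_cover A as C g \<and> branch_cover A as C g \<subseteq> C \<union> fst ` set as \<union> snd ` set as"
proof (induction as arbitrary: C g)
  case (Cons e as)
  obtain u w where e: "e = (u, w)" by force
  obtain z g' where z: "choose_end A C (u, w) g = (z, g')" by force
  then have "z = u \<or> z = w" using fst_choose_end[of A C u w g] by simp
  then show ?case using Cons.IH[of C g] Cons.IH[of "insert z C" g'] by (auto simp: e z)
qed simp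

lemma covers_branch_cover:
  "finite C \<Longrightarrow> covers (set as) (branch_cover A as C g)"
proof (induction as arbitrary: C g)
  case (Cons e as)
  obtain u w where e: "e = (u, w)" by force
  obtain z g' where z: "choose_end A C (u, w) g = (z, g')" by force
  then have "z = u \<or> z = w" using fst_choose_end[of A C u w g] by simp
  then show ?case
    using Cons.IH[of C g] Cons.IH[of "insert z C" g'] Cons.prems
      branch_cover_subset[of C A as g] branch_cover_subset[of "insert z C" A as g']
    by (auto simp: e z covers_def)
qed (simp add: covers_def)

definition extends_within :: "'a rel \<Rightarrow> nat \<Rightarrow> 'a set \<Rightarrow> 'a set \<Rightarrow> bool" where
  "extends_within A r C S \<longleftrightarrow> covers A S \<and> C \<subseteq> S \<and> 2 * card (S - C) \<le> r + double_lp A C"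

lemma extends_within_finite:
  assumes "extends_within A r C S"
  shows "finite S" "finite C"
  using assms rev_finite_subset[of S C] by (auto simp: extends_within_def covers_def)

lemma card_Diff_insert_Suc:
  "finite S \<Longrightarrow> z \<in> S \<Longrightarrow> z \<notin> C \<Longrightarrow> card (S - C) = Suc (card (S - insert z C))"
  by (metis DiffI Diff_insert card_Suc_Diff1 finite_Diff)

lemma extends_within_safe:
  assumes A: "finite A" "sym A" and S: "extends_within A r C S" and z: "z \<notin> C" "safe A C z"
  obtains S' where "extends_within A r (insert z C) S'" "card S' \<le> card S"
proof -
  have SC: "covers A S" "C \<subseteq> S" "2 * card (S - C) \<le> r + double_lp A C"
    using S by (auto simp: extends_within_def)
  obtain S' where S': "covers A S'" "insert z C \<subseteq> S'" "card S' \<le> card S"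
    using safe_persistent[OF A SC(1,2) z] by blast
  have "card (S' - C) \<le> card (S - C)"
    using S' SC(2) extends_within_finite[OF S] by (simp add: card_Diff_subset)
  moreover have "card (S' - C) = Suc (card (S' - insert z C))"
    using S' z(1) by (intro card_Diff_insert_Suc) (auto simp: covers_def)
  ultimately have "2 * card (S' - insert z C) \<le> r + double_lp A (insert z C)"
    using double_lp_insert[OF A(1), of C z] SC(3) by linarith
  then show ?thesis using that S' by (auto simp: extends_within_def)
qed

text \<open>Taking \<open>z\<close> shortens the extension by 1, but lowers twice the relaxation by at most 1.\<close>

lemma extends_within_unsafe:
  assumes S: "extends_within A r C S" and z: "z \<in> S" "z \<notin> C" "\<not> safe A C z"
  obtains q where "r = Suc q" "extends_within A q (insert z C) S"
proof -
  have "2 * Suc (card (S - insert z C)) \<le> r + double_lp A C"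
    using S card_Diff_insert_Suc[OF extends_within_finite(1)[OF S] z(1,2)]
    by (simp add: extends_within_def)
  moreover have "double_lp A C < double_lp A (insert z C) + 2" using z(3) by (simp add: safe_def)
  moreover have "double_lp A (insert z C) \<le> 2 * card (S - insert z C)"
    using S by (intro double_lp_le_cover) (simp add: extends_within_def)
  ultimately obtain q where "r = Suc q" "2 * card (S - insert z C) \<le> q + double_lp A (insert z C)"
    by (cases r) auto
  then show ?thesis using that S z(1) by (auto simp: extends_within_def)
qed

lemma extends_within_choose_end:
  assumes A: "finite A" "sym A" and S: "extends_within A r C S"
    and uw: "(u, w) \<in> A" "u \<notin> C" "w \<notin> C"
  obtains z q S' where "extends_within A q (insert z C) S'" "card S' \<le> card S"
    and "\<forall>g. (\<forall>i\<ge>q. \<not> g i) \<longrightarrow> (\<exists>g'. (\<forall>i\<ge>r. \<not> g' i) \<and> choose_end A C (u, w) g' = (z, g))"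
proof -
  consider (safe_u) "safe A C u" | (safe_w) "\<not> safe A C u" "safe A C w"
    | (unsafe) "\<not> safe A C u" "\<not> safe A C w"
    by blast
  then show ?thesis
  proof cases
    case safe_u
    then have "choose_end A C (u, w) g = (u, g)" for g by (simp add: choose_end_def)
    then show ?thesis using extends_within_safe[OF A S uw(2) safe_u] that by metis
  next
    case safe_w
    then have "choose_end A C (u, w) g = (w, g)" for g by (simp add: choose_end_def)
    then show ?thesis using extends_within_safe[OF A S uw(3) safe_w(2)] that by metis
  next
    case unsafe
    have "u \<in> S \<or> w \<in> S" using S uw(1) by (auto simp: covers_def extends_within_def)
    then obtain b z where z: "z = (if b then u else w)" "z \<in> S" by (metis (full_types))
    moreover from this have "z \<notin> C" "\<not> safe A C z" using unsafe uw by auto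
    ultimately obtain q where q: "r = Suc q" "extends_within A q (insert z C) S"
      using extends_within_unsafe[OF S] by blast
    show ?thesis
    proof (rule that[OF q(2) order_refl], intro allI impI)
      fix g :: "nat \<Rightarrow> bool" assume "\<forall>i\<ge>q. \<not> g i"
      then have "\<forall>i\<ge>r. \<not> case_nat b g i" using q(1) by (auto split: nat.split)
      moreover have "choose_end A C (u, w) (case_nat b g) = (z, g)"
        using unsafe z(1) by (simp add: choose_end_def)
      ultimately show "\<exists>g'. (\<forall>i\<ge>r. \<not> g' i) \<and> choose_end A C (u, w) g' = (z, g)" by blast
    qed
  qed
qed

lemma branch_cover_optimal:
  assumes A: "finite A" "sym A" and "extends_within A r C S" "set as \<subseteq> A"
  shows "\<exists>g. (\<forall>i\<ge>r. \<not> g i) \<and> card (branch_cover A as C g) \<le> card S"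
  using assms(3-)
proof (induction as arbitrary: C S r)
  case Nil
  then have "card C \<le> card S"
    by (intro card_mono extends_within_finite) (auto simp: extends_within_def)
  then show ?case by (intro exI[of _ "\<lambda>_. False"]) simp
next
  case (Cons e as)
  obtain u w where e: "e = (u, w)" by force
  have uw: "(u, w) \<in> A" and as: "set as \<subseteq> A" using Cons.prems(2) by (auto simp: e)
  show ?case
  proof (cases "u \<in> C \<or> w \<in> C")
    case True
    then show ?thesis using Cons.IH[OF Cons.prems(1) as] by (simp add: e)
  next
    case False
    then have uncovered: "u \<notin> C" "w \<notin> C" by auto
    obtain z q S' where z: "extends_within A q (insert z C) S'" "card S' \<le> card S"
      "\<forall>g. (\<forall>i\<ge>q. \<not> g i) \<longrightarrow> (\<exists>g'. (\<forall>i\<ge>r. \<not> g' i) \<and> choose_end A C (u, w) g' = (z, g))"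
      using extends_within_choose_end[OF A Cons.prems(1) uw uncovered] by metis
    obtain g where g: "\<forall>i\<ge>q. \<not> g i" "card (branch_cover A as (insert z C) g) \<le> card S'"
      using Cons.IH[OF z(1) as] by blast
    obtain g' where "\<forall>i\<ge>r. \<not> g' i" "choose_end A C (u, w) g' = (z, g)" using z(3) g(1) by blast
    then show ?thesis using False g(2) z(2) by (intro exI[of _ g']) (simp add: e)
  qed
qed

text \<open>The guesses encoded by \<open>x < N = 2 ^ r\<close> are its binary digits from the top; doubling modulo
  \<open>N\<close> moves to the next one.\<close>

definition digit :: "nat \<Rightarrow> nat \<Rightarrow> nat \<Rightarrow> bool" where
  "digit N x i \<longleftrightarrow> N \<le> 2 * (2 ^ i * x mod N)"

lemma digit_0: "x < N \<Longrightarrow> digit N x 0 \<longleftrightarrow> N \<le> 2 * x"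
  by (simp add: digit_def)

lemma digit_Suc: "digit N x (Suc i) = digit N (2 * x mod N) i"
  by (simp add: digit_def mod_mult_right_eq ac_simps)

lemma digit_surj:
  "(\<And>i. r \<le> i \<Longrightarrow> \<not> g i) \<Longrightarrow> \<exists>x<2 ^ r. digit (2 ^ r) x = g"
proof (induction r arbitrary: g)
  case 0
  then show ?case by (auto simp: digit_def)
next
  case (Suc r)
  have "\<not> g (Suc i)" if "r \<le> i" for i using Suc.prems that by simp
  from Suc.IH[of "\<lambda>i. g (Suc i)", OF this]
  obtain y where y: "y < 2 ^ r" "digit (2 ^ r) y = (\<lambda>i. g (Suc i))" by blast
  define x where "x = (if g 0 then 2 ^ r else 0) + y"
  have "digit (2 ^ Suc r) x (Suc i) = digit (2 ^ r) y i" for i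
  proof -
    have "2 ^ Suc i * x mod 2 ^ Suc r = 2 * (2 ^ i * x mod 2 ^ r)"
      using mult_mod_right[of 2 "2 ^ i * x" "2 ^ r"] by (simp add: mult.assoc)
    also have "2 ^ i * x mod 2 ^ r = 2 ^ i * y mod 2 ^ r"
      by (simp add: x_def distrib_left)
    finally show ?thesis by (simp add: digit_def)
  qed
  moreover have "x < 2 ^ Suc r" using y(1) by (simp add: x_def)
  moreover from this have "digit (2 ^ Suc r) x 0 = g 0" using y(1) by (simp add: digit_0 x_def)
  ultimately have "digit (2 ^ Suc r) x i = g i" for i using y(2)
    by (cases i) (simp_all add: fun_eq_iff)
  then show ?case using \<open>x < 2 ^ Suc r\<close> by blast
qed

section \<open>A structured language and its compiler\<close>

text \<open>Commands act on variables and on arrays; \<open>Elem j i\<close> is element \<open>i\<close> of array \<open>j\<close>, and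
  \<open>Word i\<close> is word \<open>i\<close> of a read-only memory \<open>w\<close>.  In \<open>run w c s k s'\<close> the number \<open>k\<close> bounds the
  running time of the compiled command.\<close>

datatype atom = Var nat | Num nat

datatype expr =
    Atom atom
  | Plus atom atom (infix \<open>\<oplus>\<close> 65)
  | Minus atom atom (infix \<open>\<ominus>\<close> 65)
  | Elem nat atom
  | Word atom

datatype com =
    Skip
  | Assign nat expr (infix \<open>::=\<close> 62)
  | Store nat atom atom
  | Seq com com (infixr \<open>;;\<close> 60)
  | Cond nat com com (\<open>(IF _/ THEN _/ ELSE _)\<close> [0, 0, 61] 61)
  | Loop nat com (\<open>(WHILE _/ DO _)\<close> [0, 61] 61)

type_synonym vars = "nat \<Rightarrow> nat"
type_synonym arrays = "nat \<Rightarrow> nat \<Rightarrow> nat"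
type_synonym state = "vars \<times> arrays"
type_synonym memory = "nat \<Rightarrow> nat option"

fun eval_atom :: "vars \<Rightarrow> atom \<Rightarrow> nat" where
  "eval_atom v (Var y) = v y"
| "eval_atom v (Num c) = c"

fun eval_expr :: "memory \<Rightarrow> state \<Rightarrow> expr \<Rightarrow> nat option" where
  "eval_expr w (v, a) (Atom e) = Some (eval_atom v e)"
| "eval_expr w (v, a) (e1 \<oplus> e2) = Some (eval_atom v e1 + eval_atom v e2)"
| "eval_expr w (v, a) (e1 \<ominus> e2) = Some (eval_atom v e1 - eval_atom v e2)"
| "eval_expr w (v, a) (Elem j i) = Some (a j (eval_atom v i))"
| "eval_expr w (v, a) (Word i) = w (eval_atom v i)"

inductive run :: "memory \<Rightarrow> com \<Rightarrow> state \<Rightarrow> nat \<Rightarrow> state \<Rightarrow> bool" for w where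
  run_Skip: "run w Skip s 0 s"
| run_Assign: "eval_expr w (v, a) e = Some c \<Longrightarrow> run w (x ::= e) (v, a) 11 (v(x := c), a)"
| run_Store: "run w (Store j i e) (v, a) 11 (v, a(j := (a j)(eval_atom v i := eval_atom v e)))"
| run_Seq: "run w c1 s1 k1 s2 \<Longrightarrow> run w c2 s2 k2 s3 \<Longrightarrow> run w (c1 ;; c2) s1 (k1 + k2) s3"
| run_CondT: "fst s x \<noteq> 0 \<Longrightarrow> run w c1 s k s' \<Longrightarrow> run w (IF x THEN c1 ELSE c2) s (k + 3) s'"
| run_CondF: "fst s x = 0 \<Longrightarrow> run w c2 s k s' \<Longrightarrow> run w (IF x THEN c1 ELSE c2) s (k + 3) s'"
| run_LoopT: "fst s x \<noteq> 0 \<Longrightarrow> run w c s k s' \<Longrightarrow> run w (WHILE x DO c) s' k' s'' \<Longrightarrow>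
     run w (WHILE x DO c) s (k + k' + 3) s''"
| run_LoopF: "fst s x = 0 \<Longrightarrow> run w (WHILE x DO c) s 3 s"

text \<open>Variable \<open>x < 40\<close> lives in register \<open>x\<close>, and element \<open>i\<close> of array \<open>j < 8\<close> at address
  \<open>b + 8 * i + j\<close>, where \<open>b\<close> is the content of the base register: the interleaving keeps unbounded
  arrays disjoint.\<close>

abbreviation (input) scratch :: nat where "scratch \<equiv> 40"
abbreviation (input) scratch' :: nat where "scratch' \<equiv> 41"
abbreviation (input) base :: nat where "base \<equiv> 42"

fun wf_atom :: "atom \<Rightarrow> bool" where
  "wf_atom (Var y) \<longleftrightarrow> y < 40"
| "wf_atom (Num c) \<longleftrightarrow> True"

fun wf_expr :: "expr \<Rightarrow> bool" where
  "wf_expr (Atom e) \<longleftrightarrow> wf_atom e"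
| "wf_expr (e1 \<oplus> e2) \<longleftrightarrow> wf_atom e1 \<and> wf_atom e2"
| "wf_expr (e1 \<ominus> e2) \<longleftrightarrow> wf_atom e1 \<and> wf_atom e2"
| "wf_expr (Elem j i) \<longleftrightarrow> j < 8 \<and> wf_atom i"
| "wf_expr (Word i) \<longleftrightarrow> wf_atom i"

fun wf_com :: "com \<Rightarrow> bool" where
  "wf_com Skip \<longleftrightarrow> True"
| "wf_com (x ::= e) \<longleftrightarrow> x < 40 \<and> wf_expr e"
| "wf_com (Store j i e) \<longleftrightarrow> j < 8 \<and> wf_atom i \<and> wf_atom e"
| "wf_com (c1 ;; c2) \<longleftrightarrow> wf_com c1 \<and> wf_com c2"
| "wf_com (IF x THEN c1 ELSE c2) \<longleftrightarrow> x < 40 \<and> wf_com c1 \<and> wf_com c2"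
| "wf_com (WHILE x DO c) \<longleftrightarrow> x < 40 \<and> wf_com c"

fun load :: "nat \<Rightarrow> atom \<Rightarrow> instr list" where
  "load r (Var y) = [LoadC r 0, Add r r y]"
| "load r (Num c) = [LoadC r c]"

definition address :: "nat \<Rightarrow> atom \<Rightarrow> instr list" where
  "address j i = load scratch i @ replicate 3 (Add scratch scratch scratch) @
     [LoadC scratch' j, Add scratch scratch scratch', Add scratch scratch base]"

fun compile_expr :: "nat \<Rightarrow> expr \<Rightarrow> instr list" where
  "compile_expr x (Atom e) = load scratch e @ [LoadC scratch' 0, Add x scratch scratch']"
| "compile_expr x (e1 \<oplus> e2) = load scratch e1 @ load scratch' e2 @ [Add x scratch scratch']"
| "compile_expr x (e1 \<ominus> e2) = load scratch e1 @ load scratch' e2 @ [Sub x scratch scratch']"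
| "compile_expr x (Elem j i) = address j i @ [LoadI x scratch]"
| "compile_expr x (Word i) = load scratch i @ [LoadI x scratch]"

definition goto :: "nat \<Rightarrow> instr list" where
  "goto q = [LoadC scratch 0, Jz scratch q]"

fun compile :: "nat \<Rightarrow> com \<Rightarrow> instr list" where
  "compile p Skip = []"
| "compile p (x ::= e) = compile_expr x e"
| "compile p (Store j i e) = address j i @ load scratch' e @ [StoreI scratch scratch']"
| "compile p (c1 ;; c2) = (let is = compile p c1 in is @ compile (p + length is) c2)"
| "compile p (IF x THEN c1 ELSE c2) =
     (let is1 = compile (p + 1) c1; q = p + length is1 + 3; is2 = compile q c2
      in [Jz x q] @ is1 @ goto (q + length is2) @ is2)"
| "compile p (WHILE x DO c) =
     (let is = compile (p + 1) c in [Jz x (p + length is + 3)] @ is @ goto p)"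

subsection \<open>Execution of machine code\<close>

fun code_at :: "instr list \<Rightarrow> nat \<Rightarrow> instr list \<Rightarrow> bool" where
  "code_at P p [] \<longleftrightarrow> True"
| "code_at P p (i # is) \<longleftrightarrow> p < length P \<and> P ! p = i \<and> code_at P (Suc p) is"

lemma code_at_append:
  "code_at P p (is @ is') \<longleftrightarrow> code_at P p is \<and> code_at P (p + length is) is'"
  by (induction "is" arbitrary: p) auto

lemma code_at_suffix: "code_at (xs @ is) (length xs) is"
proof (induction "is" arbitrary: xs)
  case (Cons i "is")
  then show ?case using Cons.IH[of "xs @ [i]"] by simp
qed simp

definition reach :: "instr list \<Rightarrow> nat \<Rightarrow> config \<Rightarrow> config \<Rightarrow> bool" where
  "reach P k c c' \<longleftrightarrow> (\<exists>s\<le>k. (step P ^^ s) c = c')"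

lemma reach_refl: "reach P 0 c c"
  by (simp add: reach_def)

lemma reach_step: "reach P 1 c (step P c)"
  unfolding reach_def by (intro exI[of _ 1]) simp

lemma reach_trans:
  assumes "reach P k c c'" "reach P l c' c''"
  shows "reach P (k + l) c c''"
proof -
  obtain s s' where "s \<le> k" "(step P ^^ s) c = c'" "s' \<le> l" "(step P ^^ s') c' = c''"
    using assms by (auto simp: reach_def)
  then show ?thesis unfolding reach_def by (intro exI[of _ "s' + s"]) (simp add: funpow_add)
qed

lemma reach_mono: "reach P k c c' \<Longrightarrow> k \<le> l \<Longrightarrow> reach P l c c'"
  unfolding reach_def using le_trans by blast

definition effect :: "instr \<Rightarrow> (nat \<Rightarrow> nat) \<Rightarrow> nat \<Rightarrow> nat" where
  "effect i m = snd (exec i (0, m))"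

lemma effect_simps [simp]:
  "effect (LoadC r c) m = m(r := c)"
  "effect (Add r x y) m = m(r := m x + m y)"
  "effect (Sub r x y) m = m(r := m x - m y)"
  "effect (LoadI r x) m = m(r := m (m x))"
  "effect (StoreI x r) m = m(m x := m r)"
  by (simp_all add: effect_def)

definition jump_free :: "instr list \<Rightarrow> bool" where
  "jump_free is \<longleftrightarrow> (\<forall>x l. Jz x l \<notin> set is)"

lemma jump_free_simps [simp]:
  "jump_free []"
  "jump_free (i # is) \<longleftrightarrow> (\<forall>x l. i \<noteq> Jz x l) \<and> jump_free is"
  "jump_free (is @ is') \<longleftrightarrow> jump_free is \<and> jump_free is'"
  by (auto simp: jump_free_def)

lemma reach_jump_free:
  assumes "code_at P p is" "jump_free is"
  shows "reach P (length is) (p, m) (p + length is, fold effect is m)"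
  using assms
proof (induction "is" arbitrary: p m)
  case Nil
  then show ?case by (simp add: reach_refl)
next
  case (Cons i "is")
  have "step P (p, m) = (Suc p, effect i m)"
    using Cons.prems by (cases i) (simp_all add: step_def)
  then have "reach P 1 (p, m) (Suc p, effect i m)" using reach_step[of P "(p, m)"] by simp
  moreover have
    "reach P (length is) (Suc p, effect i m) (Suc p + length is, fold effect is (effect i m))"
    by (rule Cons.IH) (use Cons.prems in simp_all)
  ultimately show ?case using reach_trans by fastforce
qed

lemma reach_goto: "code_at P p (goto q) \<Longrightarrow> reach P 2 (p, m) (q, m(scratch := 0))"
  unfolding reach_def by (intro exI[of _ 2]) (simp add: goto_def step_def eval_nat_numeral)

subsection \<open>Correctness of the compiler\<close>

definition rep :: "memory \<Rightarrow> state \<Rightarrow> (nat \<Rightarrow> nat) \<Rightarrow> bool" where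
  "rep w s m \<longleftrightarrow>
     (\<forall>x<40. m x = fst s x) \<and> 43 \<le> m base \<and>
     (\<forall>j<8. \<forall>i. m (m base + 8 * i + j) = snd s j i) \<and>
     (\<forall>p c. w p = Some c \<longrightarrow> 43 \<le> p \<and> p < m base \<and> m p = c)"

lemma repD:
  assumes "rep w s m"
  shows rep_varD: "x < 40 \<Longrightarrow> m x = fst s x"
    and rep_arrayD: "j < 8 \<Longrightarrow> m (m base + 8 * i + j) = snd s j i"
    and rep_baseD: "43 \<le> m base"
    and rep_wordD: "w q = Some c \<Longrightarrow> 43 \<le> q \<and> m q = c"
  using assms by (auto simp: rep_def)

lemma rep_register:
  assumes rep: "rep w s m" and r: "r < 42" and v: "\<And>x. x < 40 \<Longrightarrow> (m(r := c)) x = v x"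
  shows "rep w (v, snd s) (m(r := c))"
proof -
  have "q \<noteq> r" if "43 \<le> q" for q using r that by simp
  moreover have "43 \<le> m base + 8 * i + j" for i j using rep_baseD[OF rep] by simp
  moreover have "w r \<noteq> Some q" for q using rep_wordD[OF rep, of r q] r by auto
  ultimately show ?thesis using rep r v by (auto simp: rep_def)
qed

lemma rep_scratch: "rep w s m \<Longrightarrow> r = scratch \<or> r = scratch' \<Longrightarrow> rep w s (m(r := c))"
  using rep_register[of w s m r c "fst s"] by (auto simp: rep_varD)

lemma rep_var: "rep w (v, a) m \<Longrightarrow> x < 40 \<Longrightarrow> rep w (v(x := c), a) (m(x := c))"
  using rep_register[of w "(v, a)" m x c "v(x := c)"] by (auto simp: rep_varD)

lemma rep_array:
  assumes "rep w (v, a) m" "j < 8"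
  shows "rep w (v, a(j := (a j)(i := c))) (m(m base + 8 * i + j := c))"
proof -
  let ?p = "m base + 8 * i + j"
  have "43 \<le> ?p" "m base \<le> ?p" using assms unfolding rep_def by auto
  then have ne: "x \<noteq> ?p" if "x < 43 \<or> x < m base" for x using that by linarith
  have elem: "m base + 8 * i' + j' = ?p \<longleftrightarrow> i' = i \<and> j' = j" if "j' < 8" for i' j'
    using that assms(2) by (cases i' i rule: linorder_cases) auto
  have "(m(?p := c)) ((m(?p := c)) base + 8 * i' + j') = (a(j := (a j)(i := c))) j' i'"
    if "j' < 8" for i' j'
    using that assms elem[of j' i'] ne[of base] unfolding rep_def by auto
  then show ?thesis using assms ne by (auto simp: rep_def)
qed

lemma load_correct:
  assumes "rep w s m" "wf_atom e" "r = scratch \<or> r = scratch'"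
  shows "fold effect (load r e) m = m(r := eval_atom (fst s) e)"
  using assms rep_varD[OF assms(1)] by (cases e) auto

lemma address_correct:
  assumes "rep w s m" "wf_atom i"
  shows "fold effect (address j i) m =
    m(scratch' := j, scratch := m base + 8 * eval_atom (fst s) i + j)"
  by (auto simp: address_def load_correct[OF assms] eval_nat_numeral fun_eq_iff)

lemma jump_free_load [simp]: "jump_free (load r e)"
  by (cases e) auto

lemma length_load: "length (load r e) = (case e of Var y \<Rightarrow> 2 | Num c \<Rightarrow> 1)"
  by (cases e) auto

lemma jump_free_address [simp]: "jump_free (address j i)"
  by (simp add: address_def eval_nat_numeral)

lemma length_address: "length (address j i) = length (load scratch i) + 6"
  by (simp add: address_def)

lemma jump_free_compile_expr: "jump_free (compile_expr x e)"
  by (cases e) auto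

lemma length_compile_expr: "length (compile_expr x e) \<le> 11"
  by (cases e) (auto simp: length_address length_load split: atom.split)

lemma compile_expr_correct:
  assumes "rep w (v, a) m" "wf_expr e" "x < 40" and c: "eval_expr w (v, a) e = Some c"
  shows "rep w (v(x := c), a) (fold effect (compile_expr x e) m)"
proof -
  note load = load_correct[OF assms(1)] load_correct[OF rep_scratch[OF assms(1)]]
  note scratch = rep_var[OF rep_scratch[OF rep_scratch[OF assms(1)]]]
    rep_var[OF rep_scratch[OF assms(1)]]
  show ?thesis
  proof (cases e)
    case (Elem j i)
    then show ?thesis
      using assms scratch repD(2,3)[OF assms(1)] by (auto simp: address_correct)
  next
    case (Word i)
    then show ?thesis
      using assms scratch rep_wordD[OF assms(1), of "eval_atom v i" c] by (auto simp: load)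
  qed (use assms scratch in \<open>auto simp: load\<close>)
qed

definition simulates :: "instr list \<Rightarrow> memory \<Rightarrow> nat \<Rightarrow> nat \<Rightarrow> state \<Rightarrow> nat \<Rightarrow> state \<Rightarrow> bool" where
  "simulates P w k p s q s' \<longleftrightarrow>
     (\<forall>m. rep w s m \<longrightarrow> (\<exists>m'. reach P k (p, m) (q, m') \<and> rep w s' m'))"

lemma simulates_refl: "simulates P w 0 p s p s"
  using reach_refl by (auto simp: simulates_def)

lemma simulates_trans:
  "simulates P w k p s q s' \<Longrightarrow> simulates P w l q s' r s'' \<Longrightarrow> simulates P w (k + l) p s r s''"
  unfolding simulates_def by (meson reach_trans)

lemma simulates_mono: "simulates P w k p s q s' \<Longrightarrow> k \<le> l \<Longrightarrow> simulates P w l p s q s'"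
  unfolding simulates_def by (meson reach_mono)

lemma simulates_jump_free:
  assumes "code_at P p is" "jump_free is" "length is \<le> k"
    and "\<And>m. rep w s m \<Longrightarrow> rep w s' (fold effect is m)"
  shows "simulates P w k p s (p + length is) s'"
  unfolding simulates_def using reach_mono[OF reach_jump_free[OF assms(1,2)] assms(3)] assms(4)
  by blast

lemma simulates_Jz:
  assumes "p < length P" "P ! p = Jz x l" "x < 40"
  shows "simulates P w 1 p s (if fst s x = 0 then l else p + 1) s"
  unfolding simulates_def
proof (intro allI impI)
  fix m assume "rep w s m"
  then have "step P (p, m) = ((if fst s x = 0 then l else p + 1), m)"
    using assms by (simp add: step_def rep_varD)
  then show "\<exists>m'. reach P 1 (p, m) (if fst s x = 0 then l else p + 1, m') \<and> rep w s m'"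
    using reach_step[of P "(p, m)"] \<open>rep w s m\<close> by auto
qed

lemma simulates_goto: "code_at P p (goto q) \<Longrightarrow> simulates P w 2 p s q s"
  unfolding simulates_def using reach_goto rep_scratch by blast

lemma simulates_CondT:
  assumes code: "code_at P p (compile p (IF x THEN c1 ELSE c2))" and x: "x < 40" "fst s x \<noteq> 0"
    and body: "code_at P (p + 1) (compile (p + 1) c1) \<Longrightarrow>
      simulates P w k (p + 1) s (p + 1 + length (compile (p + 1) c1)) s'"
  shows "simulates P w (k + 3) p s (p + length (compile p (IF x THEN c1 ELSE c2))) s'"
proof -
  let ?is1 = "compile (p + 1) c1"
  let ?q = "p + length ?is1 + 3"
  let ?r = "?q + length (compile ?q c2)"
  have P: "p < length P" "P ! p = Jz x ?q" "code_at P (p + 1) ?is1"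
    "code_at P (p + 1 + length ?is1) (goto ?r)"
    using code by (simp_all add: Let_def code_at_append)
  have "simulates P w 1 p s (p + 1) s" using simulates_Jz[OF P(1,2), of w s] x by simp
  then have "simulates P w (1 + k + 2) p s ?r s'"
    using body[OF P(3)] simulates_goto[OF P(4)] by (blast intro: simulates_trans)
  then show ?thesis by (simp add: Let_def goto_def add_ac eval_nat_numeral)
qed

lemma simulates_CondF:
  assumes code: "code_at P p (compile p (IF x THEN c1 ELSE c2))" and x: "x < 40" "fst s x = 0"
    and body: "\<And>q. code_at P q (compile q c2) \<Longrightarrow> simulates P w k q s (q + length (compile q c2)) s'"
  shows "simulates P w (k + 3) p s (p + length (compile p (IF x THEN c1 ELSE c2))) s'"
proof -
  let ?q = "p + length (compile (p + 1) c1) + 3"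
  have P: "p < length P" "P ! p = Jz x ?q" "code_at P ?q (compile ?q c2)"
    using code by (simp_all add: Let_def code_at_append goto_def add_ac eval_nat_numeral)
  have "simulates P w 1 p s ?q s" using simulates_Jz[OF P(1,2), of w s] x by simp
  then have "simulates P w (1 + k) p s (?q + length (compile ?q c2)) s'"
    using body[OF P(3)] by (rule simulates_trans)
  then have "simulates P w (k + 3) p s (?q + length (compile ?q c2)) s'"
    by (rule simulates_mono) simp
  then show ?thesis by (simp add: Let_def goto_def add_ac eval_nat_numeral)
qed

lemma simulates_LoopT:
  assumes code: "code_at P p (compile p (WHILE x DO c))" and x: "x < 40" "fst s x \<noteq> 0"
    and body: "code_at P (p + 1) (compile (p + 1) c) \<Longrightarrow>
      simulates P w k (p + 1) s (p + 1 + length (compile (p + 1) c)) s'"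
    and rest: "simulates P w k' p s' (p + length (compile p (WHILE x DO c))) s''"
  shows "simulates P w (k + k' + 3) p s (p + length (compile p (WHILE x DO c))) s''"
proof -
  let ?is = "compile (p + 1) c"
  have P: "p < length P" "P ! p = Jz x (p + length ?is + 3)" "code_at P (p + 1) ?is"
    "code_at P (p + 1 + length ?is) (goto p)"
    using code by (simp_all add: Let_def code_at_append)
  have "simulates P w 1 p s (p + 1) s" using simulates_Jz[OF P(1,2), of w s] x by simp
  then have "simulates P w (1 + k + 2 + k') p s (p + length (compile p (WHILE x DO c))) s''"
    using body[OF P(3)] simulates_goto[OF P(4)] rest by (blast intro: simulates_trans)
  then show ?thesis by (simp add: add_ac eval_nat_numeral)
qed

lemma simulates_LoopF:
  assumes code: "code_at P p (compile p (WHILE x DO c))" and x: "x < 40" "fst s x = 0"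
  shows "simulates P w 3 p s (p + length (compile p (WHILE x DO c))) s"
proof -
  let ?q = "p + length (compile (p + 1) c) + 3"
  have "p < length P" "P ! p = Jz x ?q" using code by (simp_all add: Let_def)
  then have "simulates P w 1 p s ?q s" using simulates_Jz[of p P x ?q w s] x by simp
  then have "simulates P w 3 p s ?q s" by (rule simulates_mono) simp
  then show ?thesis by (simp add: Let_def goto_def add_ac eval_nat_numeral)
qed

lemma simulates_Store:
  assumes code: "code_at P p (compile p (Store j i e))" and wf: "wf_com (Store j i e)"
  shows "simulates P w 11 p (v, a) (p + length (compile p (Store j i e)))
    (v, a(j := (a j)(eval_atom v i := eval_atom v e)))"
proof (rule simulates_jump_free[OF code])
  fix m assume m: "rep w (v, a) m"
  let ?p = "m base + 8 * eval_atom v i + j"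
  let ?m = "m(scratch' := eval_atom v e, scratch := ?p)"
  have "rep w (v, a) (m(scratch' := j, scratch := ?p))" using m by (simp add: rep_scratch)
  then have "fold effect (compile p (Store j i e)) m =
      ?m(?m base + 8 * eval_atom v i + j := eval_atom v e)"
    using wf address_correct[OF m] by (simp add: load_correct fun_upd_twist)
  moreover have "rep w (v, a) ?m" using m by (simp add: rep_scratch)
  ultimately show "rep w (v, a(j := (a j)(eval_atom v i := eval_atom v e)))
      (fold effect (compile p (Store j i e)) m)"
    using rep_array[of w v a ?m j] wf by simp
qed (auto simp: length_address length_load split: atom.split)

lemma compile_correct:
  "run w c s k s' \<Longrightarrow> wf_com c \<Longrightarrow> code_at P p (compile p c) \<Longrightarrow>
   simulates P w k p s (p + length (compile p c)) s'"
proof (induction arbitrary: p rule: run.induct)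
  case (run_Skip s)
  then show ?case by (simp add: simulates_refl)
next
  case (run_Assign v a e c x)
  then show ?case
    using simulates_jump_free[OF _ jump_free_compile_expr length_compile_expr] compile_expr_correct
    by simp
next
  case (run_Store j i e v a)
  then show ?case using simulates_Store by blast
next
  case (run_Seq c1 s1 k1 s2 c2 k2 s3)
  let ?q = "p + length (compile p c1)"
  have "code_at P p (compile p c1)" "code_at P ?q (compile ?q c2)"
    using run_Seq.prems by (simp_all add: Let_def code_at_append)
  then have "simulates P w k1 p s1 ?q s2" "simulates P w k2 ?q s2 (?q + length (compile ?q c2)) s3"
    using run_Seq.IH run_Seq.prems(1) by simp_all
  from simulates_trans[OF this] show ?case by (simp add: Let_def add.assoc)
next
  case (run_CondT s x c1 k s' c2)
  then have wf: "x < 40" "wf_com c1" by auto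
  show ?case
    by (rule simulates_CondT[OF run_CondT.prems(2) wf(1) run_CondT.hyps(1) run_CondT.IH[OF wf(2)]])
next
  case (run_CondF s x c2 k s' c1)
  then have wf: "x < 40" "wf_com c2" by auto
  show ?case
    by (rule simulates_CondF[OF run_CondF.prems(2) wf(1) run_CondF.hyps(1) run_CondF.IH[OF wf(2)]])
next
  case (run_LoopT s x c k s' k' s'')
  then have wf: "x < 40" "wf_com c" by auto
  show ?case
    by (rule simulates_LoopT[OF run_LoopT.prems(2) wf(1) run_LoopT.hyps(1) run_LoopT.IH(1)[OF wf(2)]
          run_LoopT.IH(2)[OF run_LoopT.prems]])
next
  case (run_LoopF s x c)
  then show ?case by (intro simulates_LoopF) auto
qed

section \<open>Weakest preconditions\<close>

text \<open>The last argument of a postcondition is the time spent so far.\<close>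

definition wp :: "memory \<Rightarrow> com \<Rightarrow> (vars \<Rightarrow> arrays \<Rightarrow> nat \<Rightarrow> bool) \<Rightarrow> vars \<Rightarrow> arrays \<Rightarrow> nat \<Rightarrow> bool" where
  "wp w c Q v a t \<longleftrightarrow> (\<exists>v' a' k. run w c (v, a) k (v', a') \<and> Q v' a' (t + k))"

inductive_cases run_SkipE: "run w Skip s k s'"
inductive_cases run_AssignE: "run w (x ::= e) s k s'"
inductive_cases run_StoreE: "run w (Store j i e) s k s'"
inductive_cases run_SeqE: "run w (c1 ;; c2) s k s'"
inductive_cases run_CondE: "run w (IF x THEN c1 ELSE c2) s k s'"

lemma wp_Skip [simp]: "wp w Skip Q v a t \<longleftrightarrow> Q v a t"
  unfolding wp_def by (force elim: run_SkipE intro: run_Skip)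

lemma wp_Assign_iff:
  "wp w (x ::= e) Q v a t \<longleftrightarrow> (\<exists>c. eval_expr w (v, a) e = Some c \<and> Q (v(x := c)) a (t + 11))"
  unfolding wp_def by (blast elim: run_AssignE intro: run_Assign)

lemma wp_Assign [simp]:
  "wp w (x ::= Atom e) Q v a t \<longleftrightarrow> Q (v(x := eval_atom v e)) a (t + 11)"
  "wp w (x ::= e1 \<oplus> e2) Q v a t \<longleftrightarrow> Q (v(x := eval_atom v e1 + eval_atom v e2)) a (t + 11)"
  "wp w (x ::= e1 \<ominus> e2) Q v a t \<longleftrightarrow> Q (v(x := eval_atom v e1 - eval_atom v e2)) a (t + 11)"
  "wp w (x ::= Elem j i) Q v a t \<longleftrightarrow> Q (v(x := a j (eval_atom v i))) a (t + 11)"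
  "wp w (x ::= Word i) Q v a t \<longleftrightarrow> (\<exists>c. w (eval_atom v i) = Some c \<and> Q (v(x := c)) a (t + 11))"
  by (simp_all add: wp_Assign_iff)

lemma wp_Store [simp]:
  "wp w (Store j i e) Q v a t \<longleftrightarrow> Q v (a(j := (a j)(eval_atom v i := eval_atom v e))) (t + 11)"
  unfolding wp_def by (blast elim: run_StoreE intro: run_Store)

lemma wp_Seq [simp]: "wp w (c1 ;; c2) Q = wp w c1 (wp w c2 Q)"
proof (intro ext iffI)
  fix v a t
  assume "wp w (c1 ;; c2) Q v a t"
  then show "wp w c1 (wp w c2 Q) v a t"
    unfolding wp_def by (fastforce elim!: run_SeqE simp: add.assoc)
next
  fix v a t
  assume "wp w c1 (wp w c2 Q) v a t"
  then show "wp w (c1 ;; c2) Q v a t"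
    unfolding wp_def by (metis run_Seq add.assoc)
qed

lemma run_Cond_iff:
  "run w (IF x THEN c1 ELSE c2) s k s' \<longleftrightarrow>
     (\<exists>l. k = l + 3 \<and> run w (if fst s x \<noteq> 0 then c1 else c2) s l s')"
  by (auto elim: run_CondE intro: run_CondT run_CondF)

lemma wp_Cond [simp]:
  "wp w (IF x THEN c1 ELSE c2) Q v a t \<longleftrightarrow> wp w (if v x \<noteq> 0 then c1 else c2) Q v a (t + 3)"
proof -
  have "t + (l + 3) = t + 3 + l" for l by simp
  then show ?thesis unfolding wp_def run_Cond_iff fst_conv by metis
qed

subsection \<open>Frames\<close>

fun mod_vars :: "com \<Rightarrow> nat set" where
  "mod_vars (x ::= e) = {x}"
| "mod_vars (c1 ;; c2) = mod_vars c1 \<union> mod_vars c2"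
| "mod_vars (IF x THEN c1 ELSE c2) = mod_vars c1 \<union> mod_vars c2"
| "mod_vars (WHILE x DO c) = mod_vars c"
| "mod_vars _ = {}"

fun mod_arrays :: "com \<Rightarrow> nat set" where
  "mod_arrays (Store j i e) = {j}"
| "mod_arrays (c1 ;; c2) = mod_arrays c1 \<union> mod_arrays c2"
| "mod_arrays (IF x THEN c1 ELSE c2) = mod_arrays c1 \<union> mod_arrays c2"
| "mod_arrays (WHILE x DO c) = mod_arrays c"
| "mod_arrays _ = {}"

definition frame :: "com \<Rightarrow> vars \<Rightarrow> arrays \<Rightarrow> vars \<Rightarrow> arrays \<Rightarrow> bool" where
  "frame c v a v' a' \<longleftrightarrow> (\<forall>x. x \<notin> mod_vars c \<longrightarrow> v' x = v x) \<and> (\<forall>j. j \<notin> mod_arrays c \<longrightarrow> a' j = a j)"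

lemma run_frame: "run w c s k s' \<Longrightarrow> frame c (fst s) (snd s) (fst s') (snd s')"
  by (induction rule: run.induct) (auto simp: frame_def)

lemma wp_conseq:
  assumes "wp w c Q v a t" and "\<And>v' a' t'. Q v' a' t' \<Longrightarrow> frame c v a v' a' \<Longrightarrow> Q' v' a' t'"
  shows "wp w c Q' v a t"
  using assms run_frame unfolding wp_def by fastforce

subsection \<open>Loops\<close>

lemma wp_Loop:
  fixes \<mu> :: "vars \<Rightarrow> arrays \<Rightarrow> nat"
  assumes init: "I v a t"
    and step: "\<And>v' a' t'. I v' a' t' \<Longrightarrow> frame c v a v' a' \<Longrightarrow> v' x \<noteq> 0 \<Longrightarrow>
      wp w c (\<lambda>v'' a'' t''. I v'' a'' (t'' + 3) \<and> \<mu> v'' a'' < \<mu> v' a') v' a' t'"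
    and exit: "\<And>v' a' t'. I v' a' t' \<Longrightarrow> frame c v a v' a' \<Longrightarrow> v' x = 0 \<Longrightarrow> Q v' a' (t' + 3)"
  shows "wp w (WHILE x DO c) Q v a t"
proof -
  have "wp w (WHILE x DO c) Q v' a' t'" if "I v' a' t'" "frame c v a v' a'" for v' a' t'
    using that
  proof (induction "\<mu> v' a'" arbitrary: v' a' t' rule: less_induct)
    case less
    show ?case
    proof (cases "v' x = 0")
      case True
      then show ?thesis
        using exit[OF less.prems True] run_LoopF[of "(v', a')" x w c] unfolding wp_def by auto
    next
      case False
      obtain v'' a'' k where body: "run w c (v', a') k (v'', a'')" "I v'' a'' (t' + k + 3)"
        "\<mu> v'' a'' < \<mu> v' a'"
        using step[OF less.prems False] unfolding wp_def by blast
      have "frame c v a v'' a''" using run_frame[OF body(1)] less.prems(2) by (auto simp: frame_def)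
      then obtain v_end a_end k' where rest: "run w (WHILE x DO c) (v'', a'') k' (v_end, a_end)"
        "Q v_end a_end (t' + k + 3 + k')"
        using less.hyps[OF body(3,2)] unfolding wp_def by blast
      have "run w (WHILE x DO c) (v', a') (k + k' + 3) (v_end, a_end)"
        using run_LoopT[OF _ body(1) rest(1)] False by simp
      moreover have "t' + k + 3 + k' = t' + (k + k' + 3)" by simp
      ultimately show ?thesis using rest(2) unfolding wp_def by metis
    qed
  qed
  then show ?thesis using init by (simp add: frame_def)
qed

definition For :: "nat \<Rightarrow> nat \<Rightarrow> com \<Rightarrow> com" (\<open>(FOR _/ BELOW _/ DO _)\<close> [0, 0, 61] 61) where
  "(FOR i BELOW N DO c) = (i ::= Atom (Var N) ;; WHILE i DO (i ::= Var i \<ominus> Num 1 ;; c))"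

lemma For_simps [simp]:
  "mod_vars (FOR i BELOW N DO c) = insert i (mod_vars c)"
  "mod_arrays (FOR i BELOW N DO c) = mod_arrays c"
  "wf_com (FOR i BELOW N DO c) \<longleftrightarrow> i < 40 \<and> N < 40 \<and> wf_com c"
  by (auto simp: For_def)

text \<open>The loop counts down: \<open>I j\<close> holds when exactly the indices from \<open>j\<close> on have been processed.\<close>

lemma wp_For:
  assumes fresh: "i \<notin> mod_vars c"
    and init: "I (v N) v a"
    and step: "\<And>j v' a' t'. j < v N \<Longrightarrow> v' i = j \<Longrightarrow> frame (FOR i BELOW N DO c) v a v' a' \<Longrightarrow>
      I (Suc j) v' a' \<Longrightarrow> wp w c (\<lambda>v'' a'' t''. I j v'' a'' \<and> t'' \<le> t' + K) v' a' t'"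
    and stable: "\<And>j v' a' y. I j v' a' \<Longrightarrow> I j (v'(i := y)) a'"
    and exit: "\<And>v' a' t'. I 0 v' a' \<Longrightarrow> frame (FOR i BELOW N DO c) v a v' a' \<Longrightarrow>
      t' \<le> t + 14 + v N * (K + 14) \<Longrightarrow> Q v' a' t'"
  shows "wp w (FOR i BELOW N DO c) Q v a t"
proof -
  let ?frame = "frame (FOR i BELOW N DO c) v a"
  define J where "J v' a' t' \<longleftrightarrow> v' i \<le> v N \<and> I (v' i) v' a' \<and> ?frame v' a' \<and>
    t' + v' i * (K + 14) \<le> t + 11 + v N * (K + 14)" for v' a' t'
  have "wp w (WHILE i DO (i ::= Var i \<ominus> Num 1 ;; c)) Q (v(i := v N)) a (t + 11)"
  proof (rule wp_Loop[where I = J and \<mu> = "\<lambda>v a. v i"])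
    show "J (v(i := v N)) a (t + 11)"
      using stable[OF init] by (simp add: J_def frame_def)
  next
    fix v' a' t'
    assume J: "J v' a' t'" and "v' i \<noteq> 0"
    then obtain j where j: "v' i = Suc j" using not0_implies_Suc by blast
    have "wp w c (\<lambda>v'' a'' t''. I j v'' a'' \<and> t'' \<le> t' + 11 + K) (v'(i := j)) a' (t' + 11)"
      by (rule step) (use J j stable in \<open>auto simp: J_def frame_def\<close>)
    then have "wp w c (\<lambda>v'' a'' t''. J v'' a'' (t'' + 3) \<and> v'' i < v' i) (v'(i := j)) a' (t' + 11)"
      by (rule wp_conseq) (use J j fresh in \<open>auto simp: J_def frame_def\<close>)
    then show "wp w (i ::= Var i \<ominus> Num 1 ;; c) (\<lambda>v'' a'' t''. J v'' a'' (t'' + 3) \<and>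
        v'' i < v' i) v' a' t'"
      using j by simp
  next
    fix v' a' t'
    assume "J v' a' t'" and "v' i = 0"
    then show "Q v' a' (t' + 3)" by (intro exit) (auto simp: J_def)
  qed
  then show ?thesis by (simp add: For_def)
qed

section \<open>The relaxation as a program\<close>

text \<open>Registers 0 to 3 initially hold the first words of the input, the third one modified to be an
  address beyond the input.  A bidder \<open>u\<close> is stored as \<open>u + 1\<close>, with 0 for none, and likewise the
  elements of \<open>partners\<close>.\<close>

abbreviation (input) max_degree :: nat where "max_degree \<equiv> 0"
abbreviation (input) excess :: nat where "excess \<equiv> 1"
abbreviation (input) input_end :: nat where "input_end \<equiv> 2"
abbreviation (input) num_edges :: nat where "num_edges \<equiv> 3"
abbreviation (input) num_vertices :: nat where "num_vertices \<equiv> 4"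
abbreviation (input) num_arcs :: nat where "num_arcs \<equiv> 5"
abbreviation (input) num_guesses :: nat where "num_guesses \<equiv> 6"
abbreviation (input) budget :: nat where "budget \<equiv> 7"
abbreviation (input) trial_index :: nat where "trial_index \<equiv> 8"
abbreviation (input) guess :: nat where "guess \<equiv> 9"
abbreviation (input) cost :: nat where "cost \<equiv> 10"
abbreviation (input) answer :: nat where "answer \<equiv> 11"
abbreviation (input) arc :: nat where "arc \<equiv> 12"
abbreviation (input) arc_tail :: nat where "arc_tail \<equiv> 13"
abbreviation (input) arc_head :: nat where "arc_head \<equiv> 14"
abbreviation (input) chosen :: nat where "chosen \<equiv> 15"
abbreviation (input) optimum :: nat where "optimum \<equiv> 16"
abbreviation (input) matched :: nat where "matched \<equiv> 17"
abbreviation (input) vertex :: nat where "vertex \<equiv> 18"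
abbreviation (input) bidder :: nat where "bidder \<equiv> 19"
abbreviation (input) best_price :: nat where "best_price \<equiv> 20"
abbreviation (input) best_item :: nat where "best_item \<equiv> 21"
abbreviation (input) scanned_arc :: nat where "scanned_arc \<equiv> 22"
abbreviation (input) item :: nat where "item \<equiv> 23"
abbreviation (input) price :: nat where "price \<equiv> 24"
abbreviation (input) flag :: nat where "flag \<equiv> 25"
abbreviation (input) temp :: nat where "temp \<equiv> 26"
abbreviation (input) edge :: nat where "edge \<equiv> 27"
abbreviation (input) position :: nat where "position \<equiv> 28"

abbreviation (input) tails :: nat where "tails \<equiv> 2"
abbreviation (input) heads :: nat where "heads \<equiv> 3"
abbreviation (input) in_cover :: nat where "in_cover \<equiv> 4"
abbreviation (input) prices :: nat where "prices \<equiv> 5"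
abbreviation (input) partners :: nat where "partners \<equiv> 6"

definition stored_arc :: "arrays \<Rightarrow> nat \<Rightarrow> nat \<times> nat" where
  "stored_arc a e = (a tails e, a heads e)"

definition graph_loaded :: "nat \<Rightarrow> (nat \<times> nat) set \<Rightarrow> vars \<Rightarrow> arrays \<Rightarrow> bool" where
  "graph_loaded n A v a \<longleftrightarrow>
     v num_vertices = n \<and> A = stored_arc a ` {..<v num_arcs} \<and> A \<subseteq> {..<n} \<times> {..<n}"

lemma graph_loaded_cong:
  assumes "graph_loaded n A v a"
    and "v' num_vertices = v num_vertices" "v' num_arcs = v num_arcs" "a' tails = a tails"
      "a' heads = a heads"
  shows "graph_loaded n A v' a'"
proof -
  have "stored_arc a' = stored_arc a" using assms by (simp add: stored_arc_def fun_eq_iff)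
  then show ?thesis using assms unfolding graph_loaded_def by metis
qed

definition stored_cover :: "nat \<Rightarrow> arrays \<Rightarrow> nat set" where
  "stored_cover n a = {z. z < n \<and> a in_cover z \<noteq> 0}"

subsection \<open>A single bid\<close>

definition cheapest :: "(nat \<times> nat) set \<Rightarrow> nat \<Rightarrow> (nat \<Rightarrow> nat) \<Rightarrow> nat \<Rightarrow> nat \<Rightarrow> nat \<Rightarrow> bool" where
  "cheapest A N D u z p \<longleftrightarrow>
     p \<le> N \<and> (\<forall>y. (u, y) \<in> A \<longrightarrow> p \<le> D y) \<and> (p < N \<longrightarrow> (u, z) \<in> A \<and> D z = p)"

lemma cheapest_insert:
  assumes "cheapest A N D u z p"
  shows "u' \<noteq> u \<or> p \<le> D y \<Longrightarrow> cheapest (insert (u', y) A) N D u z p"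
    and "u' = u \<Longrightarrow> D y < p \<Longrightarrow> cheapest (insert (u', y) A) N D u y (D y)"
  using assms by (auto simp: cheapest_def)

definition scan :: com where
  "scan =
     best_price ::= Atom (Var num_vertices) ;;
     FOR scanned_arc BELOW num_arcs DO (
       temp ::= Elem tails (Var scanned_arc) ;; temp ::= Var temp \<oplus> Num 1 ;;
       flag ::= Var temp \<ominus> Var bidder ;; temp ::= Var bidder \<ominus> Var temp ;;
       flag ::= Var flag \<oplus> Var temp ;;
       IF flag THEN Skip ELSE (
         item ::= Elem heads (Var scanned_arc) ;; price ::= Elem prices (Var item) ;;
         flag ::= Var best_price \<ominus> Var price ;;
         IF flag THEN best_price ::= Atom (Var price) ;; best_item ::= Atom (Var item) ELSE Skip))"

lemma mod_scan [simp]: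
  "mod_vars scan = {best_price, best_item, scanned_arc, item, price, flag, temp}"
  "mod_arrays scan = {}"
  by (auto simp: scan_def)

definition scan_time :: "nat \<Rightarrow> nat" where
  "scan_time m = 25 + m * 130"

lemma wp_scan:
  assumes loaded: "graph_loaded n A v a" and u: "v bidder = Suc u"
    and Q: "\<And>v' t'. cheapest A n (a prices) u (v' best_item) (v' best_price) \<Longrightarrow>
      frame scan v a v' a \<Longrightarrow> t' \<le> t + scan_time (v num_arcs) \<Longrightarrow> Q v' a t'"
  shows "wp w scan Q v a t"
proof -
  let ?I = "\<lambda>j v' a'. a' = a \<and>
    cheapest (stored_arc a ` {j..<v num_arcs}) n (a prices) u (v' best_item) (v' best_price)"
  have "wp w scan (\<lambda>v' a' t'. ?I 0 v' a' \<and> t' \<le> t + scan_time (v num_arcs)) v a t"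
    unfolding scan_def wp_Seq wp_Assign
  proof (rule wp_For[where I = ?I and K = 116], goal_cases fresh init step stable exit)
    case init
    then show ?case using loaded by (simp add: cheapest_def graph_loaded_def)
  next
    case (step j v' a' t')
    have "{j..<v num_arcs} = insert j {Suc j..<v num_arcs}" using step(1) by auto
    then have "stored_arc a ` {j..<v num_arcs} =
        insert (a tails j, a heads j) (stored_arc a ` {Suc j..<v num_arcs})"
      by (simp add: stored_arc_def)
    moreover have "v' bidder = Suc u" using step(3) u by (simp add: frame_def)
    ultimately show ?case using step cheapest_insert by (auto simp: not_le)
  qed (simp_all add: scan_time_def)
  then show ?thesis
    by (rule wp_conseq) (use loaded Q in \<open>auto simp: graph_loaded_def lessThan_atLeast0\<close>)
qed

definition place_bid :: com where
  "place_bid =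
     best_price ::= Var best_price \<oplus> Num 1 ;; Store prices (Var best_item) (Var best_price) ;;
     temp ::= Elem partners (Var best_item) ;; Store partners (Var best_item) (Var bidder) ;;
     bidder ::= Atom (Var temp) ;; IF bidder THEN Skip ELSE matched ::= Var matched \<oplus> Num 1"

definition bid :: com where
  "bid =
     scan ;; flag ::= Var num_vertices \<ominus> Var best_price ;;
     IF flag THEN place_bid ELSE bidder ::= Atom (Num 0)"

lemma mod_bid [simp]:
  "mod_vars bid = {bidder, matched} \<union> mod_vars scan" "mod_arrays bid = {prices, partners}"
  by (auto simp: bid_def place_bid_def)

definition partner_map :: "nat \<Rightarrow> (nat \<Rightarrow> nat) \<Rightarrow> nat \<rightharpoonup> nat" where
  "partner_map n p z = (if z < n \<and> p z \<noteq> 0 then Some (p z - 1) else None)"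

lemma set_option_partner_map: "z < n \<Longrightarrow> set_option (partner_map n p z) = {u. Suc u = p z}"
  by (auto simp: partner_map_def)

lemma partner_map_upd: "z < n \<Longrightarrow> partner_map n (p(z := Suc u)) = (partner_map n p)(z \<mapsto> u)"
  by (auto simp: partner_map_def)

lemma dom_partner_map: "dom (partner_map n p) = {z. z < n \<and> p z \<noteq> 0}"
  by (auto simp: partner_map_def split: if_splits)

text \<open>The left vertices in \<open>G\<close> are settled except the bidder.  Deleted vertices have the prohibitive
  price \<open>n\<close>.\<close>

definition auction_at :: "nat \<Rightarrow> (nat \<times> nat) set \<Rightarrow> nat set \<Rightarrow> nat set \<Rightarrow> vars \<Rightarrow> arrays \<Rightarrow> bool" where
  "auction_at n A C G v a \<longleftrightarrow>
     auction (Restr A (- C)) n (G - {u. Suc u = v bidder}) (a prices) (partner_map n (a partners)) \<and>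
     {u. Suc u = v bidder} \<subseteq> G \<and> v matched = card (dom (partner_map n (a partners))) \<and>
     (\<forall>z<n. z \<in> C \<longrightarrow> a prices z = n)"

text \<open>Bounds the number of bids still to come.\<close>

definition potential :: "nat \<Rightarrow> vars \<Rightarrow> arrays \<Rightarrow> nat" where
  "potential n v a = (if v bidder = 0 then 0 else Suc (\<Sum>z<n. n - a prices z))"

lemma potential_le: "potential n v a \<le> n * n + 1"
proof -
  have "(\<Sum>z<n. n - a prices z) \<le> (\<Sum>z<n. n)" by (rule sum_mono) simp
  then show ?thesis by (simp add: potential_def)
qed

lemma potential_raise_price:
  assumes "z < n" "a prices z < n" "v bidder \<noteq> 0" "a' prices = (a prices)(z := Suc (a prices z))"
  shows "potential n v' a' < potential n v a"
proof -
  have "(\<Sum>y<n. n - a' prices y) < (\<Sum>y<n. n - a prices y)"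
    by (rule sum_strict_mono_ex1) (use assms in auto)
  then show ?thesis using assms(3) by (simp add: potential_def)
qed

context
  fixes n :: nat and A :: "(nat \<times> nat) set" and C G :: "nat set"
  assumes A: "A \<subseteq> {..<n} \<times> {..<n}" and G: "G \<inter> C = {}"
begin

lemma auction_at_bid:
  assumes at: "auction_at n A C G v a" and u: "v bidder = Suc u"
    and z: "cheapest A n (a prices) u z p" "p < n"
    and a': "a' = a(prices := (a prices)(z := Suc p), partners := (a partners)(z := Suc u))"
    and v': "v' bidder = a partners z"
      "v' matched = v matched + (if a partners z = 0 then 1 else 0)"
  shows "auction_at n A C G v' a'"
proof -
  have auction: "auction (Restr A (- C)) n (G - {u}) (a prices) (partner_map n (a partners))"
    and uG: "u \<in> G" and card: "v matched = card (dom (partner_map n (a partners)))"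
    and deleted: "\<forall>z<n. z \<in> C \<longrightarrow> a prices z = n"
    using at u by (auto simp: auction_at_def)
  have uz: "(u, z) \<in> A" "a prices z = p" and least: "\<And>y. (u, y) \<in> A \<Longrightarrow> p \<le> a prices y"
    using z by (auto simp: cheapest_def)
  then have zn: "z < n" "z \<notin> C" using A deleted z(2) by auto
  have u_free: "u \<notin> C" using uG G by auto
  have "auction (Restr A (- C)) n (insert u (G - {u}) - set_option (partner_map n (a partners) z))
      ((a prices)(z := Suc (a prices z))) ((partner_map n (a partners))(z \<mapsto> u))"
    by (rule auction.settle_by_bid[OF auction]) (use uz zn u_free least in auto)
  then have "auction (Restr A (- C)) n (G - {x. Suc x = v' bidder}) (a' prices)
      (partner_map n (a' partners))"
    using uG uz zn v' by (simp add: a' set_option_partner_map partner_map_upd insert_absorb)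
  moreover have "{x. Suc x = v' bidder} \<subseteq> G"
    using auction.partner_settled[OF auction, of z]
      v'(1) set_option_partner_map[OF zn(1), of "a partners"]
    by auto
  moreover have "dom (partner_map n (a' partners)) = insert z (dom (partner_map n (a partners)))"
    using zn(1) by (auto simp: a' dom_partner_map)
  then have "v' matched = card (dom (partner_map n (a' partners)))"
    using v'(2) card zn(1) by (simp add: card_insert_if dom_partner_map)
  moreover have "\<forall>y<n. y \<in> C \<longrightarrow> a' prices y = n" using deleted zn(2) by (auto simp: a')
  ultimately show ?thesis by (simp add: auction_at_def)
qed

lemma auction_at_give_up:
  assumes at: "auction_at n A C G v a" and u: "v bidder = Suc u"
    and hopeless: "cheapest A n (a prices) u z n"
    and v': "v' bidder = 0" "v' matched = v matched"
  shows "auction_at n A C G v' a"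
proof -
  have "auction (Restr A (- C)) n (G - {u}) (a prices) (partner_map n (a partners))" "u \<in> G"
    using at u by (auto simp: auction_at_def)
  then have "auction (Restr A (- C)) n G (a prices) (partner_map n (a partners))"
    using auction.settle_hopeless[of "Restr A (- C)" n "G - {u}" _ _ u] hopeless
    by (auto simp: cheapest_def insert_absorb)
  then show ?thesis using at v' by (simp add: auction_at_def)
qed

end

lemma wp_place_bid:
  assumes loaded: "graph_loaded n A v a" and G: "G \<inter> C = {}"
    and at: "auction_at n A C G v a" and u: "v bidder = Suc u"
    and v': "v' bidder = Suc u" "v' matched = v matched"
    and best: "cheapest A n (a prices) u (v' best_item) (v' best_price)" "v' best_price < n"
    and Q: "\<And>v'' a' t'. auction_at n A C G v'' a' \<Longrightarrow> potential n v'' a' < potential n v a \<Longrightarrow>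
      t' \<le> t + 69 \<Longrightarrow> Q v'' a' t'"
  shows "wp w place_bid Q v' a t"
proof -
  define z where "z = v' best_item"
  let ?a = "a(prices := (a prices)(z := Suc (v' best_price)), partners := (a partners)(z := Suc u))"
  have subset: "A \<subseteq> {..<n} \<times> {..<n}" using loaded by (auto simp: graph_loaded_def)
  have z: "z < n" "a prices z = v' best_price"
    using best subset by (auto simp: cheapest_def z_def)
  have "Q v'' ?a t'" if "v'' bidder = a partners z"
    "v'' matched = v matched + (if a partners z = 0 then 1 else 0)" "t' \<le> t + 69" for v'' t'
  proof (rule Q)
    show "auction_at n A C G v'' ?a"
      using auction_at_bid[OF subset G at u best[folded z_def] refl that(1,2)] .
    show "potential n v'' ?a < potential n v a"
      using z best(2) u by (intro potential_raise_price[of z]) auto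
  qed (fact that(3))
  then show ?thesis using v' by (simp add: place_bid_def z_def)
qed

definition bid_time :: "nat \<Rightarrow> nat" where
  "bid_time m = scan_time m + 83"

lemma wp_bid:
  assumes loaded: "graph_loaded n A v a" and G: "G \<inter> C = {}" and at: "auction_at n A C G v a"
    and bidder: "v bidder \<noteq> 0"
    and Q: "\<And>v' a' t'. auction_at n A C G v' a' \<Longrightarrow> potential n v' a' < potential n v a \<Longrightarrow>
      t' \<le> t + bid_time (v num_arcs) \<Longrightarrow> Q v' a' t'"
  shows "wp w bid Q v a t"
proof -
  obtain u where u: "v bidder = Suc u" using bidder not0_implies_Suc by blast
  have subset: "A \<subseteq> {..<n} \<times> {..<n}" and n: "v num_vertices = n"
    using loaded by (auto simp: graph_loaded_def)
  show ?thesis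
    unfolding bid_def wp_Seq wp_Assign
  proof (rule wp_scan[OF loaded u])
    fix v' t'
    assume best: "cheapest A n (a prices) u (v' best_item) (v' best_price)"
      and "frame scan v a v' a" and time: "t' \<le> t + scan_time (v num_arcs)"
    then have regs: "v' num_vertices = n" "v' bidder = Suc u" "v' matched = v matched"
      using n u by (auto simp: frame_def)
    let ?v = "v'(flag := eval_atom v' (Var num_vertices) - eval_atom v' (Var best_price))"
    show "wp w (IF flag THEN place_bid ELSE bidder ::= Atom (Num 0)) Q ?v a (t' + 11)"
    proof (cases "v' best_price < n")
      case True
      have "wp w place_bid Q ?v a (t' + 11 + 3)"
      proof (rule wp_place_bid[OF loaded G at u])
        fix v'' a'' t''
        assume "auction_at n A C G v'' a''" "potential n v'' a'' < potential n v a"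
          "t'' \<le> t' + 11 + 3 + 69"
        then show "Q v'' a'' t''" using time by (intro Q) (simp_all add: bid_time_def)
      qed (use best True regs in simp_all)
      then show ?thesis using True regs by simp
    next
      case False
      then have p: "v' best_price = n" using best by (simp add: cheapest_def)
      have "Q v'' a t''" if "v'' bidder = 0" "v'' matched = v matched" "t'' \<le> t' + 25" for v'' t''
      proof (rule Q)
        show "auction_at n A C G v'' a"
          using auction_at_give_up[OF subset G at u best[unfolded p] that(1,2)] .
        show "potential n v'' a < potential n v a" using that(1) bidder by (simp add: potential_def)
      qed (use that(3) time in \<open>simp add: bid_time_def\<close>)
      then show ?thesis using p regs by simp
    qed
  qed
qed

subsection \<open>The value of the relaxation\<close>

definition bids_time :: "nat \<Rightarrow> nat \<Rightarrow> nat" where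
  "bids_time n m = (bid_time m + 3) * (n * n + 1) + 3"

lemma wp_bids:
  assumes loaded: "graph_loaded n A v a" and G: "G \<inter> C = {}" and at: "auction_at n A C G v a"
    and Q: "\<And>v' a' t'. auction_at n A C G v' a' \<Longrightarrow> v' bidder = 0 \<Longrightarrow>
      t' \<le> t + bids_time n (v num_arcs) \<Longrightarrow> Q v' a' t'"
  shows "wp w (WHILE bidder DO bid) Q v a t"
proof -
  let ?K = "bid_time (v num_arcs) + 3"
  define I where "I v' a' t' \<longleftrightarrow> auction_at n A C G v' a' \<and>
    t' + ?K * potential n v' a' \<le> t + ?K * (n * n + 1)" for v' a' t'
  show ?thesis
  proof (rule wp_Loop[where I = I and \<mu> = "potential n"])
    show "I v a t"
      using at potential_le[of n v a]
      by (simp only: I_def add_le_cancel_left mult_le_mono2 simp_thms)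
  next
    fix v' a' t'
    assume I: "I v' a' t'" and frame: "frame bid v a v' a'" and bidder: "v' bidder \<noteq> 0"
    have loaded': "graph_loaded n A v' a'"
      by (rule graph_loaded_cong[OF loaded]) (use frame in \<open>auto simp: frame_def\<close>)
    have at': "auction_at n A C G v' a'" using I by (simp add: I_def)
    show "wp w bid (\<lambda>v'' a'' t''. I v'' a'' (t'' + 3) \<and>
        potential n v'' a'' < potential n v' a') v' a' t'"
    proof (rule wp_bid[OF loaded' G at' bidder])
      fix v'' a'' t''
      assume at: "auction_at n A C G v'' a''" and less: "potential n v'' a'' < potential n v' a'"
        and "t'' \<le> t' + bid_time (v' num_arcs)"
      then have "t'' + 3 \<le> t' + ?K" using frame by (simp add: frame_def)
      moreover have "?K * Suc (potential n v'' a'') \<le> ?K * potential n v' a'"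
        using less by (intro mult_le_mono2) simp
      ultimately have "t'' + 3 + ?K * potential n v'' a'' \<le> t + ?K * (n * n + 1)"
        using I by (simp add: I_def)
      with at less show "I v'' a'' (t'' + 3) \<and> potential n v'' a'' < potential n v' a'"
        by (simp add: I_def)
    qed
  next
    fix v' a' t'
    assume "I v' a' t'" "v' bidder = 0"
    then show "Q v' a' (t' + 3)" by (intro Q) (auto simp: I_def bids_time_def)
  qed
qed

definition start_auction :: com where
  "start_auction =
     FOR vertex BELOW num_vertices DO (
       temp ::= Elem in_cover (Var vertex) ;;
       IF temp THEN Store prices (Var vertex) (Var num_vertices)
       ELSE Store prices (Var vertex) (Num 0) ;;
       Store partners (Var vertex) (Num 0)) ;;
     matched ::= Atom (Num 0) ;; bidder ::= Atom (Num 0)"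

lemma mod_start_auction [simp]:
  "mod_vars start_auction = {vertex, temp, matched, bidder}"
  "mod_arrays start_auction = {prices, partners}"
  by (auto simp: start_auction_def)

lemma wp_start_auction:
  assumes loaded: "graph_loaded n A v a"
    and Q: "\<And>v' a' t'. auction_at n A (stored_cover n a) {} v' a' \<Longrightarrow> v' bidder = 0 \<Longrightarrow>
      frame start_auction v a v' a' \<Longrightarrow> t' \<le> t + 36 + n * 50 \<Longrightarrow> Q v' a' t'"
  shows "wp w start_auction Q v a t"
proof -
  let ?C = "stored_cover n a"
  have n: "v num_vertices = n" and subset: "A \<subseteq> {..<n} \<times> {..<n}"
    using loaded by (auto simp: graph_loaded_def)
  let ?I = "\<lambda>j v' a'. \<forall>z<n. j \<le> z \<longrightarrow> a' prices z = (if z \<in> ?C then n else 0) \<and> a' partners z = 0"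
  have "wp w start_auction (\<lambda>v' a' t'. auction_at n A ?C {} v' a' \<and> v' bidder = 0 \<and>
      t' \<le> t + 36 + n * 50) v a t"
    unfolding start_auction_def wp_Seq
  proof (rule wp_For[where I = ?I and K = 36], goal_cases fresh init step stable exit)
    case (step j v' a' t')
    then show ?case using n by (auto simp: frame_def stored_cover_def le_Suc_eq)
  next
    case (exit v' a' t')
    then have "partner_map n (a' partners) = Map.empty" by (auto simp: partner_map_def)
    moreover have "auction (Restr A (- ?C)) n {} (a' prices) Map.empty"
      by (rule auction_init) (use exit(1) subset in auto)
    ultimately show ?case using exit n by (auto simp: auction_at_def)
  qed (use n in auto)
  then show ?thesis by (rule wp_conseq) (elim conjE, rule Q)
qed

definition settle_all :: com where
  "settle_all =
     FOR vertex BELOW num_vertices DO (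
       temp ::= Elem in_cover (Var vertex) ;;
       IF temp THEN Skip ELSE (bidder ::= Var vertex \<oplus> Num 1 ;; WHILE bidder DO bid))"

lemma mod_settle_all [simp]:
  "mod_vars settle_all = {vertex} \<union> mod_vars bid" "mod_arrays settle_all = {prices, partners}"
  by (auto simp: settle_all_def)

lemma wp_settle_all:
  assumes loaded: "graph_loaded n A v a" and C: "C = stored_cover n a"
    and start: "auction_at n A C {} v a" "v bidder = 0"
    and Q: "\<And>v' a' t'. auction_at n A C ({..<n} - C) v' a' \<Longrightarrow> v' bidder = 0 \<Longrightarrow>
      t' \<le> t + 14 + n * (bids_time n (v num_arcs) + 39) \<Longrightarrow> Q v' a' t'"
  shows "wp w settle_all Q v a t"
  unfolding settle_all_def
proof (rule wp_For[where K = "bids_time n (v num_arcs) + 25" and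
      I = "\<lambda>j v' a'. auction_at n A C ({j..<n} - C) v' a' \<and> v' bidder = 0"],
    goal_cases fresh init step stable exit)
  case (step j v' a' t')
  have j: "j < n" and m: "v' num_arcs = v num_arcs" and in_cover: "a' in_cover j = a in_cover j"
    using step(1,3) loaded by (auto simp: frame_def graph_loaded_def)
  have at: "auction_at n A C ({Suc j..<n} - C) v' a'" and idle: "v' bidder = 0"
    using step(4) by auto
  show ?case
  proof (cases "j \<in> C")
    case True
    then have "{j..<n} - C = {Suc j..<n} - C" by (auto simp: Suc_le_eq le_less)
    moreover have "a' in_cover j \<noteq> 0" using True in_cover by (simp add: C stored_cover_def)
    ultimately show ?thesis using step(2) at idle by (simp add: auction_at_def)
  next
    case False
    let ?v = "v'(temp := 0, bidder := Suc j)"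
    have "{j..<n} - C = insert j ({Suc j..<n} - C)" using False j by auto
    then have at': "auction_at n A C ({j..<n} - C) ?v a'"
      using at idle by (simp add: auction_at_def insert_Diff_if)
    have loaded': "graph_loaded n A ?v a'"
      by (rule graph_loaded_cong[OF loaded]) (use step(3) in \<open>auto simp: frame_def\<close>)
    have "a' in_cover j = 0" using False j in_cover by (simp add: C stored_cover_def)
    moreover have "wp w (WHILE bidder DO bid)
        (\<lambda>v'' a'' t''. (auction_at n A C ({j..<n} - C) v'' a'' \<and> v'' bidder = 0) \<and>
          t'' \<le> t' + (bids_time n (v num_arcs) + 25)) ?v a' (t' + 25)"
      by (rule wp_bids[OF loaded' _ at']) (use m in auto)
    ultimately show ?thesis using step(2) by (simp add: add.commute)
  qed
next
  case (exit v' a' t')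
  then show ?case
    using loaded by (intro Q) (auto simp: lessThan_atLeast0 graph_loaded_def algebra_simps)
qed (use start loaded in \<open>auto simp: auction_at_def graph_loaded_def\<close>)

lemma auction_at_matched:
  assumes subset: "A \<subseteq> {..<n} \<times> {..<n}" and at: "auction_at n A C ({..<n} - C) v a"
    and "v bidder = 0"
  shows "v matched = double_lp A C"
proof -
  let ?R = "Restr A (- C)"
  have "auction ?R n ({..<n} - C) (a prices) (partner_map n (a partners))"
    using at assms(3) by (simp add: auction_at_def)
  moreover have "finite ?R" by (rule finite_subset[of _ "{..<n} \<times> {..<n}"]) (use subset in auto)
  moreover have "card (Range ?R) \<le> n"
    using subset by (intro card_mono[of "{..<n}", simplified]) auto
  ultimately have "card (dom (partner_map n (a partners))) = bicover_number ?R"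
    by (intro auction.card_dom_eq_bicover_number) (use subset in auto)
  then show ?thesis using at by (simp add: auction_at_def double_lp_def)
qed

definition relax :: com where
  "relax = start_auction ;; settle_all"

lemma mod_relax [simp]:
  "mod_vars relax = {vertex} \<union> mod_vars bid" "mod_arrays relax = {prices, partners}"
  by (auto simp: relax_def)

definition relax_time :: "nat \<Rightarrow> nat \<Rightarrow> nat" where
  "relax_time n m = 50 + n * (bids_time n m + 89)"

lemma wp_relax:
  assumes loaded: "graph_loaded n A v a"
    and Q: "\<And>v' a' t'. v' matched = double_lp A (stored_cover n a) \<Longrightarrow> frame relax v a v' a' \<Longrightarrow>
      t' \<le> t + relax_time n (v num_arcs) \<Longrightarrow> Q v' a' t'"
  shows "wp w relax Q v a t"
proof -
  let ?C = "stored_cover n a"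
  let ?Q = "\<lambda>v' a' t'. v' matched = double_lp A ?C \<and> t' \<le> t + relax_time n (v num_arcs)"
  have subset: "A \<subseteq> {..<n} \<times> {..<n}" using loaded by (auto simp: graph_loaded_def)
  have "wp w relax ?Q v a t"
    unfolding relax_def wp_Seq
  proof (rule wp_start_auction[OF loaded])
    fix v' a' t'
    assume start: "auction_at n A ?C {} v' a'" "v' bidder = 0"
      and frame: "frame start_auction v a v' a'"
      and time: "t' \<le> t + 36 + n * 50"
    have loaded': "graph_loaded n A v' a'"
      by (rule graph_loaded_cong[OF loaded]) (use frame in \<open>auto simp: frame_def\<close>)
    have C: "?C = stored_cover n a'" "v' num_arcs = v num_arcs"
      using frame by (simp_all add: frame_def stored_cover_def)
    show "wp w settle_all ?Q v' a' t'"
    proof (rule wp_settle_all[OF loaded' C(1) start], intro conjI)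
      fix v'' a'' t''
      assume "auction_at n A ?C ({..<n} - ?C) v'' a''" "v'' bidder = 0"
        and "t'' \<le> t' + 14 + n * (bids_time n (v' num_arcs) + 39)"
      then show "v'' matched = double_lp A ?C" "t'' \<le> t + relax_time n (v num_arcs)"
        using auction_at_matched[OF subset] time C(2)
        by (simp_all add: relax_time_def algebra_simps)
    qed
  qed
  then show ?thesis by (rule wp_conseq) (elim conjE, rule Q)
qed

section \<open>The branching algorithm as a program\<close>

definition probe :: "nat \<Rightarrow> com" where
  "probe x =
     Store in_cover (Var x) (Num 1) ;; relax ;; Store in_cover (Var x) (Num 0) ;;
     flag ::= Var matched \<oplus> Num 2 ;; flag ::= Var flag \<ominus> Var optimum"

lemma mod_probe [simp]:
  "mod_vars (probe x) = mod_vars relax" "mod_arrays (probe x) = {in_cover, prices, partners}"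
  by (auto simp: probe_def)

lemma wp_probe:
  assumes loaded: "graph_loaded n A v a" and C: "C = stored_cover n a"
    and z: "z = v x" "z < n" "z \<notin> C"
    and x: "x \<notin> mod_vars relax" and optimum: "v optimum = double_lp A C"
    and Q: "\<And>v' a' t'. (v' flag = 0 \<longleftrightarrow> safe A C z) \<Longrightarrow> stored_cover n a' = C \<Longrightarrow>
      frame (probe x) v a v' a' \<Longrightarrow> t' \<le> t + relax_time n (v num_arcs) + 44 \<Longrightarrow> Q v' a' t'"
  shows "wp w (probe x) Q v a t"
proof -
  let ?Q = "\<lambda>v' a' t'. (v' flag = 0 \<longleftrightarrow> safe A C z) \<and> stored_cover n a' = C \<and>
    t' \<le> t + relax_time n (v num_arcs) + 44"
  let ?a = "a(in_cover := (a in_cover)(z := 1))"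
  have loaded': "graph_loaded n A v ?a" by (rule graph_loaded_cong[OF loaded]) auto
  have insert: "stored_cover n ?a = insert z C" using z(2) by (auto simp: C stored_cover_def)
  have "wp w relax (wp w (Store in_cover (Var x) (Num 0) ;;
      flag ::= Var matched \<oplus> Num 2 ;; flag ::= Var flag \<ominus> Var optimum) ?Q) v ?a (t + 11)"
  proof (rule wp_relax[OF loaded'])
    fix v' a' t'
    assume "v' matched = double_lp A (stored_cover n ?a)" and frame: "frame relax v ?a v' a'"
      and "t' \<le> t + 11 + relax_time n (v num_arcs)"
    moreover have "v' x = z" "v' optimum = double_lp A C"
      using frame x z(1) optimum by (simp_all add: frame_def)
    moreover have "stored_cover n (a'(in_cover := (a' in_cover)(z := 0))) = C"
      using frame z(3) by (auto simp: frame_def C stored_cover_def)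
    ultimately show "wp w (Store in_cover (Var x) (Num 0) ;;
        flag ::= Var matched \<oplus> Num 2 ;; flag ::= Var flag \<ominus> Var optimum) ?Q v' a' t'"
      unfolding insert by (simp add: safe_def)
  qed
  then have "wp w (probe x) ?Q v a t" using z(1) by (simp add: probe_def)
  then show ?thesis by (rule wp_conseq) (elim conjE, rule Q)
qed

definition read_guess :: com where
  "read_guess =
     guess ::= Var guess \<oplus> Var guess ;;
     flag ::= Var guess \<oplus> Num 1 ;; flag ::= Var flag \<ominus> Var num_guesses ;;
     IF flag THEN (guess ::= Var guess \<ominus> Var num_guesses ;; chosen ::= Atom (Var arc_tail))
     ELSE Skip"

lemma double_mod: "x < N \<Longrightarrow> 2 * x mod N = (if N \<le> 2 * x then 2 * x - N else 2 * x)" for x N :: nat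
  by (simp add: le_mod_geq)

lemma wp_read_guess:
  assumes N: "N = v num_guesses" and x: "x = v guess" "x < N"
    and Q: "\<And>v' t'. v' chosen = (if digit N x 0 then v arc_tail else v chosen) \<Longrightarrow>
      v' guess = 2 * x mod N \<Longrightarrow> frame read_guess v a v' a \<Longrightarrow> t' \<le> t + 58 \<Longrightarrow> Q v' a t'"
  shows "wp w read_guess Q v a t"
proof -
  have "wp w read_guess (\<lambda>v' a' t'. v' chosen = (if digit N x 0 then v arc_tail else v chosen) \<and>
      v' guess = 2 * x mod N \<and> t' \<le> t + 58 \<and> a' = a) v a t"
    using assms(1-3) by (auto simp: read_guess_def digit_0 double_mod)
  then show ?thesis by (rule wp_conseq) (simp add: Q)
qed

text \<open>The number \<open>x\<close> encodes the guesses that have not been used yet.\<close>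

definition branch_point :: "nat \<Rightarrow> (nat \<times> nat) set \<Rightarrow> nat set \<Rightarrow> nat \<Rightarrow> nat \<Rightarrow> nat \<Rightarrow> nat \<Rightarrow>
    vars \<Rightarrow> arrays \<Rightarrow> bool" where
  "branch_point n A C u z N x v a \<longleftrightarrow>
     graph_loaded n A v a \<and> stored_cover n a = C \<and>
     v arc_tail = u \<and> v arc_head = z \<and> {u, z} \<subseteq> {..<n} - C \<and>
     v num_guesses = N \<and> v guess = x \<and> x < N"

lemma branch_point_cong:
  assumes "branch_point n A C u z N x v a"
    and "\<And>y. y \<in> {num_vertices, num_arcs, arc_tail, arc_head, num_guesses, guess} \<Longrightarrow> v' y = v y"
    and "a' tails = a tails" "a' heads = a heads" "stored_cover n a' = stored_cover n a"
  shows "branch_point n A C u z N x v' a'"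
  using assms graph_loaded_cong[of n A v a v' a'] by (simp add: branch_point_def)

definition end_picked :: "nat \<Rightarrow> (nat \<times> nat) set \<Rightarrow> nat set \<Rightarrow> nat \<Rightarrow> nat \<Rightarrow> nat \<Rightarrow> nat \<Rightarrow>
    vars \<Rightarrow> arrays \<Rightarrow> bool" where
  "end_picked n A C u z N x v a \<longleftrightarrow>
     (v chosen, digit N (v guess)) = choose_end A C (u, z) (digit N x) \<and> v guess < N \<and>
     stored_cover n a = C"

definition pick_head :: com where
  "pick_head =
     chosen ::= Atom (Var arc_head) ;; probe arc_head ;; IF flag THEN read_guess ELSE Skip"

lemma wp_pick_head:
  assumes point: "branch_point n A C u z N x v a" and optimum: "v optimum = double_lp A C"
    and unsafe: "\<not> safe A C u"
  shows "wp w pick_head (\<lambda>v' a' t'. end_picked n A C u z N x v' a' \<and>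
    t' \<le> t + relax_time n (v num_arcs) + 120) v a t" (is "wp w _ ?Q v a t")
proof -
  let ?v = "v(chosen := z)"
  have point': "branch_point n A C u z N x ?v a" by (rule branch_point_cong[OF point]) auto
  have here: "graph_loaded n A ?v a" "C = stored_cover n a" "z = ?v arc_head" "z < n" "z \<notin> C"
    and regs: "v arc_tail = u" "v num_guesses = N" "v guess = x" "x < N"
    using point' by (auto simp: branch_point_def)
  have "wp w (probe arc_head) (wp w (IF flag THEN read_guess ELSE Skip) ?Q) ?v a (t + 11)"
  proof (rule wp_probe[OF here])
    fix v' a' t'
    assume flag: "(v' flag = 0) = safe A C z" and cover: "stored_cover n a' = C"
      and frame: "frame (probe arc_head) ?v a v' a'"
      and time: "t' \<le> t + 11 + relax_time n (?v num_arcs) + 44"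
    have regs': "v' num_guesses = N" "v' guess = x" "v' arc_tail = u" "v' chosen = z"
      using frame regs by (simp_all add: frame_def)
    show "wp w (IF flag THEN read_guess ELSE Skip) ?Q v' a' t'"
    proof (cases "safe A C z")
      case True
      then show ?thesis
        using flag unsafe regs' regs(4) cover time by (simp add: end_picked_def choose_end_def)
    next
      case False
      have "wp w read_guess ?Q v' a' (t' + 3)"
      proof (rule wp_read_guess[OF regs'(1)[symmetric] regs'(2)[symmetric] regs(4)])
        fix v'' t''
        assume "v'' chosen = (if digit N x 0 then v' arc_tail else v' chosen)"
          "v'' guess = 2 * x mod N" "t'' \<le> t' + 3 + 58"
        then show "?Q v'' a' t''"
          using False unsafe regs'(3,4) cover time regs(4)
          by (auto simp: end_picked_def choose_end_def digit_Suc)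
      qed
      then show ?thesis using flag False by simp
    qed
  qed (use optimum in simp_all)
  then show ?thesis using here(3) by (simp add: pick_head_def)
qed

definition pick_tail :: com where
  "pick_tail =
     chosen ::= Atom (Var arc_tail) ;; probe arc_tail ;; IF flag THEN pick_head ELSE Skip"

lemma wp_pick_tail:
  assumes point: "branch_point n A C u z N x v a" and optimum: "v optimum = double_lp A C"
  shows "wp w pick_tail (\<lambda>v' a' t'. end_picked n A C u z N x v' a' \<and>
    t' \<le> t + 2 * relax_time n (v num_arcs) + 180) v a t" (is "wp w _ ?Q v a t")
proof -
  let ?v = "v(chosen := u)"
  have point': "branch_point n A C u z N x ?v a" by (rule branch_point_cong[OF point]) auto
  have here: "graph_loaded n A ?v a" "C = stored_cover n a" "u = ?v arc_tail" "u < n" "u \<notin> C"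
    and x: "v guess = x" "x < N"
    using point' by (auto simp: branch_point_def)
  have "wp w (probe arc_tail) (wp w (IF flag THEN pick_head ELSE Skip) ?Q) ?v a (t + 11)"
  proof (rule wp_probe[OF here])
    fix v' a' t'
    assume flag: "(v' flag = 0) = safe A C u" and cover: "stored_cover n a' = C"
      and frame: "frame (probe arc_tail) ?v a v' a'"
      and time: "t' \<le> t + 11 + relax_time n (?v num_arcs) + 44"
    show "wp w (IF flag THEN pick_head ELSE Skip) ?Q v' a' t'"
    proof (cases "safe A C u")
      case True
      then show ?thesis
        using flag frame x cover time by (simp add: end_picked_def choose_end_def frame_def)
    next
      case False
      have "branch_point n A C u z N x v' a'"
        by (rule branch_point_cong[OF point]) (use frame here(2) cover in \<open>auto simp: frame_def\<close>)
      then have "wp w pick_head ?Q v' a' (t' + 3)"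
        by (rule wp_conseq[OF wp_pick_head[OF _ _ False]])
           (use frame optimum time in \<open>auto simp: frame_def\<close>)
      then show ?thesis using flag False by simp
    qed
  qed (use optimum in simp_all)
  then show ?thesis using here(3) by (simp add: pick_tail_def)
qed

definition pick :: com where
  "pick = relax ;; optimum ::= Atom (Var matched) ;; pick_tail"

lemma mod_pick [simp]:
  "mod_vars pick = {optimum, chosen, guess} \<union> mod_vars relax"
  "mod_arrays pick = {in_cover, prices, partners}"
  by (auto simp: pick_def pick_tail_def pick_head_def read_guess_def)

lemma wp_pick:
  assumes point: "branch_point n A C u z N x v a"
    and Q: "\<And>v' a' t'. end_picked n A C u z N x v' a' \<Longrightarrow> frame pick v a v' a' \<Longrightarrow>
      t' \<le> t + 3 * relax_time n (v num_arcs) + 191 \<Longrightarrow> Q v' a' t'"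
  shows "wp w pick Q v a t"
proof -
  let ?Q = "\<lambda>v' a' t'. end_picked n A C u z N x v' a' \<and>
      t' \<le> t + 3 * relax_time n (v num_arcs) + 191"
  have loaded: "graph_loaded n A v a" and C: "stored_cover n a = C"
    using point by (simp_all add: branch_point_def)
  have "wp w pick ?Q v a t"
    unfolding pick_def wp_Seq wp_Assign
  proof (rule wp_relax[OF loaded])
    fix v' a' t'
    assume matched: "v' matched = double_lp A (stored_cover n a)" and frame: "frame relax v a v' a'"
      and time: "t' \<le> t + relax_time n (v num_arcs)"
    let ?v = "v'(optimum := eval_atom v' (Var matched))"
    have "branch_point n A C u z N x ?v a'"
      by (rule branch_point_cong[OF point]) (use frame in \<open>auto simp: frame_def stored_cover_def\<close>)
    then show "wp w pick_tail ?Q ?v a' (t' + 11)"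
      by (rule wp_conseq[OF wp_pick_tail]) (use matched C frame time in \<open>auto simp: frame_def\<close>)
  qed
  then show ?thesis by (rule wp_conseq) (elim conjE, rule Q)
qed

definition extend_cover :: com where
  "extend_cover = pick ;; Store in_cover (Var chosen) (Num 1) ;; cost ::= Var cost \<oplus> Var max_degree"

lemma mod_extend_cover [simp]:
  "mod_vars extend_cover = {cost} \<union> mod_vars pick"
  "mod_arrays extend_cover = {in_cover, prices, partners}"
  by (auto simp: extend_cover_def)

lemma wp_extend_cover:
  assumes point: "branch_point n A C u z N x v a" and cost: "v cost = v max_degree * card C"
    and Q: "\<And>v' a' t' y. (y, digit N (v' guess)) = choose_end A C (u, z) (digit N x) \<Longrightarrow>
      stored_cover n a' = insert y C \<Longrightarrow> v' cost = v max_degree * card (insert y C) \<Longrightarrow> v' guess < N \<Longrightarrow>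
      t' \<le> t + 3 * relax_time n (v num_arcs) + 213 \<Longrightarrow> Q v' a' t'"
  shows "wp w extend_cover Q v a t"
  unfolding extend_cover_def wp_Seq
proof (rule wp_pick[OF point])
  fix v' a' t'
  assume picked: "end_picked n A C u z N x v' a'" and frame: "frame pick v a v' a'"
    and time: "t' \<le> t + 3 * relax_time n (v num_arcs) + 191"
  define y where "y = v' chosen"
  have choice: "(y, digit N (v' guess)) = choose_end A C (u, z) (digit N x)" "v' guess < N"
    and C': "stored_cover n a' = C" using picked by (auto simp: end_picked_def y_def)
  have "y \<in> {u, z}" using fst_choose_end[of A C u z "digit N x"] by (simp flip: choice(1))
  then have y: "y < n" "y \<notin> C" using point by (auto simp: branch_point_def)
  let ?v = "v'(cost := v' cost + v' max_degree)" and ?a = "a'(in_cover := (a' in_cover)(y := 1))"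
  have "Q ?v ?a (t' + 22)"
  proof (rule Q)
    show "(y, digit N (?v guess)) = choose_end A C (u, z) (digit N x)" "?v guess < N"
      using choice by simp_all
    show "stored_cover n ?a = insert y C" using y(1) C' by (auto simp: stored_cover_def)
    have "finite C" by (simp add: stored_cover_def flip: C')
    then show "?v cost = v max_degree * card (insert y C)"
      using frame cost y(2) by (simp add: frame_def)
  qed (use time in simp)
  then show "wp w (Store in_cover (Var chosen) (Num 1))
      (wp w (cost ::= Var cost \<oplus> Var max_degree) Q) v' a' t'" by (simp add: y_def add.commute)
qed

definition branch :: com where
  "branch =
     arc_tail ::= Elem tails (Var arc) ;; arc_head ::= Elem heads (Var arc) ;;
     temp ::= Elem in_cover (Var arc_tail) ;; flag ::= Elem in_cover (Var arc_head) ;;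
     flag ::= Var flag \<oplus> Var temp ;;
     IF flag THEN Skip ELSE extend_cover"

lemma mod_branch [simp]:
  "mod_vars branch = {arc_tail, arc_head} \<union> mod_vars extend_cover"
  "mod_arrays branch = {in_cover, prices, partners}"
  by (auto simp: branch_def)

definition branch_time :: "nat \<Rightarrow> nat \<Rightarrow> nat" where
  "branch_time n m = 3 * relax_time n m + 271"

lemma wp_branch:
  assumes loaded: "graph_loaded n A v a" and e: "v arc < v num_arcs" "e = stored_arc a (v arc)"
    and C: "C = stored_cover n a" and cost: "v cost = v max_degree * card C"
    and N: "N = v num_guesses" and x: "x = v guess" "x < N"
    and Q: "\<And>v' a' t'.
      \<forall>as. branch_cover A as (stored_cover n a') (digit N (v' guess)) =
          branch_cover A (e # as) C (digit N x) \<Longrightarrow>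
      v' cost = v max_degree * card (stored_cover n a') \<Longrightarrow> v' guess < N \<Longrightarrow>
      t' \<le> t + branch_time n (v num_arcs) \<Longrightarrow> Q v' a' t'"
  shows "wp w branch Q v a t"
proof -
  obtain u z where uz: "e = (u, z)" "u = a tails (v arc)" "z = a heads (v arc)"
    using e(2) by (simp add: stored_arc_def)
  have "e \<in> A" using loaded e by (auto simp: graph_loaded_def)
  then have bounds: "u < n" "z < n" using loaded uz(1) by (auto simp: graph_loaded_def)
  let ?v = "v(arc_tail := u, arc_head := z, temp := a in_cover u,
    flag := a in_cover z + a in_cover u)"
  have "wp w (IF flag THEN Skip ELSE extend_cover) Q ?v a (t + 55)"
  proof (cases "u \<in> C \<or> z \<in> C")
    case True
    then have "a in_cover z + a in_cover u \<noteq> 0" by (auto simp: C stored_cover_def)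
    moreover have "Q ?v a (t + 58)"
      by (rule Q) (use True uz(1) C cost x in \<open>auto simp: branch_time_def\<close>)
    ultimately show ?thesis by (simp add: add.commute)
  next
    case False
    have "graph_loaded n A ?v a" by (rule graph_loaded_cong[OF loaded]) auto
    then have "branch_point n A C u z N x ?v a"
      using C N x bounds False by (simp add: branch_point_def)
    then have "wp w extend_cover Q ?v a (t + 58)"
    proof (rule wp_extend_cover)
      fix v' a' t' y
      assume choice: "(y, digit N (v' guess)) = choose_end A C (u, z) (digit N x)"
        and cover: "stored_cover n a' = insert y C"
        and "v' cost = ?v max_degree * card (insert y C)"
        and "v' guess < N" "t' \<le> t + 58 + 3 * relax_time n (?v num_arcs) + 213"
      moreover have "branch_cover A as (insert y C) (digit N (v' guess)) =
          branch_cover A (e # as) C (digit N x)"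
        for as using False uz(1) by (simp flip: choice)
      ultimately show "Q v' a' t'" by (intro Q) (simp_all add: branch_time_def)
    qed (use cost in simp)
    then show ?thesis using False bounds by (simp add: C stored_cover_def add.commute)
  qed
  then show ?thesis using uz by (simp add: branch_def)
qed

definition arc_list :: "nat \<Rightarrow> arrays \<Rightarrow> (nat \<times> nat) list" where
  "arc_list m a = map (stored_arc a) (rev [0..<m])"

lemma arc_list_Suc: "arc_list (Suc m) a = stored_arc a m # arc_list m a"
  by (simp add: arc_list_def)

lemma arc_list_cong: "a' tails = a tails \<Longrightarrow> a' heads = a heads \<Longrightarrow> arc_list m a' = arc_list m a"
  by (simp add: arc_list_def stored_arc_def)

definition branch_all :: com where
  "branch_all = FOR arc BELOW num_arcs DO branch"

lemma mod_branch_all [simp]: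
  "mod_vars branch_all = {arc} \<union> mod_vars branch"
  "mod_arrays branch_all = {in_cover, prices, partners}"
  by (auto simp: branch_all_def)

lemma wp_branch_all:
  assumes loaded: "graph_loaded n A v a" and empty: "stored_cover n a = {}" "v cost = 0"
    and N: "N = v num_guesses" and x: "x = v guess" "x < N"
    and Q: "\<And>v' a' t'.
      v' cost = v max_degree * card (branch_cover A (arc_list (v num_arcs) a) {} (digit N x)) \<Longrightarrow>
      frame branch_all v a v' a' \<Longrightarrow> t' \<le> t + 14 + v num_arcs * (branch_time n (v num_arcs) + 14) \<Longrightarrow>
          Q v' a' t'"
  shows "wp w branch_all Q v a t"
  unfolding branch_all_def
proof (rule wp_For[where K = "branch_time n (v num_arcs)" and I = "\<lambda>j v' a'. v' guess < N \<and>
      branch_cover A (arc_list j a) (stored_cover n a') (digit N (v' guess)) =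
        branch_cover A (arc_list (v num_arcs) a) {} (digit N x) \<and>
      v' cost = v max_degree * card (stored_cover n a')"], goal_cases fresh init step stable exit)
  case (step j v' a' t')
  have regs: "v' num_vertices = v num_vertices" "v' num_arcs = v num_arcs" "N = v' num_guesses"
    "v' max_degree = v max_degree" and arrays: "a' tails = a tails" "a' heads = a heads"
    using step(3) N by (auto simp: frame_def)
  have loaded': "graph_loaded n A v' a'"
    by (rule graph_loaded_cong[OF loaded]) (use regs arrays in simp_all)
  have "v' arc < v' num_arcs" "stored_arc a j = stored_arc a' (v' arc)"
    using step(1,2) regs arrays by (simp_all add: stored_arc_def)
  then show ?case
    using step(4) regs
    by (intro wp_branch[OF loaded' _ _ refl _ regs(3) refl]) (auto simp: arc_list_Suc)
next
  case (exit v' a' t')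
  then show ?case by (intro Q) (simp_all add: arc_list_def branch_all_def)
qed (use empty x in simp_all)

definition trial :: com where
  "trial =
     guess ::= Atom (Var trial_index) ;; cost ::= Atom (Num 0) ;;
     FOR vertex BELOW num_vertices DO Store in_cover (Var vertex) (Num 0) ;;
     branch_all ;;
     flag ::= Var cost \<ominus> Var budget ;; IF flag THEN Skip ELSE answer ::= Atom (Num 1)"

lemma mod_trial [simp]:
  "mod_vars trial = {vertex, guess, answer} \<union> mod_vars branch_all"
  "mod_arrays trial = {in_cover, prices, partners}"
  by (auto simp: trial_def)

definition trial_time :: "nat \<Rightarrow> nat \<Rightarrow> nat" where
  "trial_time n m = 75 + n * 25 + m * (branch_time n m + 14)"

lemma wp_trial:
  assumes loaded: "graph_loaded n A v a" and N: "N = v num_guesses"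
    and x: "x = v trial_index" "x < N"
    and arcs: "L = arc_list (v num_arcs) a"
  shows "wp w trial (\<lambda>v' a' t'.
      v' answer =
        (if v max_degree * card (branch_cover A L {} (digit N x)) \<le> v budget then 1 else v answer) \<and>
      t' \<le> t + trial_time n (v num_arcs)) v a t" (is "wp w trial ?Q v a t")
  unfolding trial_def wp_Seq wp_Assign
proof (rule wp_For[where K = 11 and I = "\<lambda>j v' a'. \<forall>z<n. j \<le> z \<longrightarrow> a' in_cover z = 0"],
    goal_cases fresh init step stable exit)
  case init
  then show ?case using loaded by (simp add: graph_loaded_def)
next
  case (step j v' a' t')
  then show ?case by (auto simp: le_Suc_eq)
next
  case (exit v' a' t')
  have regs: "v' y = v y" if "y \<notin> {guess, cost, vertex}" for y using exit(2) that
    by (simp add: frame_def)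
  have arrays: "a' tails = a tails" "a' heads = a heads" using exit(2) by (simp_all add: frame_def)
  have start: "stored_cover n a' = {}" "v' cost = 0" "N = v' num_guesses" "x = v' guess"
    and time: "t' \<le> t + 36 + n * 25"
    using exit loaded x(1) N by (auto simp: frame_def stored_cover_def graph_loaded_def)
  have "graph_loaded n A v' a'" by (rule graph_loaded_cong[OF loaded]) (use regs arrays in simp_all)
  then show ?case
  proof (rule wp_branch_all[OF _ start x(2)])
    fix v'' a'' t''
    assume "v'' cost =
        v' max_degree * card (branch_cover A (arc_list (v' num_arcs) a') {} (digit N x))"
      and "frame branch_all v' a' v'' a''"
      and "t'' \<le> t' + 14 + v' num_arcs * (branch_time n (v' num_arcs) + 14)"
    then show "wp w (IF flag THEN Skip ELSE answer ::= Atom (Num 1)) ?Q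
        (v''(flag := eval_atom v'' (Var cost) - eval_atom v'' (Var budget))) a'' (t'' + 11)"
      using arcs regs time arc_list_cong[OF arrays] by (auto simp: frame_def trial_time_def)
  qed
qed simp_all

definition search :: com where
  "search = answer ::= Atom (Num 0) ;; FOR trial_index BELOW num_guesses DO trial"

lemma mod_search [simp]:
  "mod_vars search = {trial_index} \<union> mod_vars trial"
  "mod_arrays search = {in_cover, prices, partners}"
  by (auto simp: search_def)

lemma wp_search:
  assumes loaded: "graph_loaded n A v a" and N: "N = v num_guesses"
    and arcs: "L = arc_list (v num_arcs) a"
    and Q: "\<And>v' a' t'.
      v' answer =
        (if \<exists>x<N. v max_degree * card (branch_cover A L {} (digit N x)) \<le> v budget then 1 else 0) \<Longrightarrow>
      frame search v a v' a' \<Longrightarrow> t' \<le> t + 25 + N * (trial_time n (v num_arcs) + 14) \<Longrightarrow> Q v' a' t'"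
  shows "wp w search Q v a t"
proof -
  let ?fits = "\<lambda>x. v max_degree * card (branch_cover A L {} (digit N x)) \<le> v budget"
  have "wp w search (\<lambda>v' a' t'. v' answer = (if \<exists>x<N. ?fits x then 1 else 0) \<and>
      t' \<le> t + 25 + N * (trial_time n (v num_arcs) + 14)) v a t"
    unfolding search_def wp_Seq wp_Assign
  proof (rule wp_For[where K = "trial_time n (v num_arcs)" and
        I = "\<lambda>j v' a'. v' answer = (if \<exists>x<N. j \<le> x \<and> ?fits x then 1 else 0)"],
      goal_cases fresh init step stable exit)
    case (step j v' a' t')
    have frame: "v' num_vertices = v num_vertices" "v' num_arcs = v num_arcs" "v' num_guesses = N"
      "v' max_degree = v max_degree" "v' budget = v budget" "a' tails = a tails"
        "a' heads = a heads"
      using step(3) N by (auto simp: frame_def)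
    have loaded': "graph_loaded n A v' a'"
      by (rule graph_loaded_cong[OF loaded]) (use frame in simp_all)
    have arcs': "L = arc_list (v' num_arcs) a'" using arcs frame arc_list_cong[of a' a] by simp
    have j: "j < N" using step(1) N by simp
    have first: "(\<exists>x<N. j \<le> x \<and> ?fits x) \<longleftrightarrow> ?fits j \<or> (\<exists>x<N. Suc j \<le> x \<and> ?fits x)"
      using j by (auto simp: Suc_le_eq le_less)
    show ?case
      by (rule wp_conseq[OF wp_trial[OF loaded' frame(3)[symmetric] step(2)[symmetric] j arcs']])
         (use step(4) frame in \<open>auto simp: first\<close>)
  qed (use N in auto)
  then show ?thesis by (rule wp_conseq) (elim conjE, rule Q)
qed

section \<open>Reading the input\<close>

text \<open>The registers overlay the first 43 input words; words 3 to 42 have been moved to the end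
  of the input, at \<open>Z\<close>.\<close>

definition moved_input :: "nat \<Rightarrow> (nat \<Rightarrow> nat) \<Rightarrow> memory" where
  "moved_input Z f p =
     (if 43 \<le> p \<and> p < Z then Some (f p)
      else if Z \<le> p \<and> p < Z + 40 then Some (f (p - Z + 3)) else None)"

definition fetch :: "nat \<Rightarrow> com" where
  "fetch x =
     flag ::= Num 43 \<ominus> Var position ;;
     IF flag THEN (temp ::= Var position \<oplus> Var input_end ;; temp ::= Var temp \<ominus> Num 3)
     ELSE temp ::= Atom (Var position) ;;
     x ::= Word (Var temp)"

lemma mod_fetch [simp]: "mod_vars (fetch x) = {flag, temp, x}" "mod_arrays (fetch x) = {}"
  by (auto simp: fetch_def)

lemma wp_fetch:
  assumes Z: "v input_end = Z" and i: "i = v position" "3 \<le> i" "i < Z"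
    and Q: "\<And>v' t'. v' x = f i \<Longrightarrow> frame (fetch x) v a v' a \<Longrightarrow> t' \<le> t + 47 \<Longrightarrow> Q v' a t'"
  shows "wp (moved_input Z f) (fetch x) Q v a t"
proof -
  have "moved_input Z f (i + Z - 3) = Some (f i)" if "i < 43"
    using that i by (auto simp: moved_input_def intro: arg_cong[where f = f])
  moreover have "moved_input Z f i = Some (f i)" if "\<not> i < 43"
    using that i by (auto simp: moved_input_def)
  ultimately have "wp (moved_input Z f) (fetch x) (\<lambda>v' a' t'. v' x = f i \<and> a' = a \<and>
      t' \<le> t + 47) v a t"
    using Z i(1) by (cases "i < 43") (simp_all add: fetch_def)
  then show ?thesis by (rule wp_conseq) (simp add: Q)
qed

definition input_edge :: "(nat \<Rightarrow> nat) \<Rightarrow> nat \<Rightarrow> nat \<times> nat" where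
  "input_edge f e = (f (4 + 2 * e), f (5 + 2 * e))"

definition copy :: com where
  "copy =
     FOR edge BELOW num_edges DO (
       position ::= Var edge \<oplus> Var edge ;; position ::= Var position \<oplus> Num 4 ;; fetch arc_tail ;;
       position ::= Var position \<oplus> Num 1 ;; fetch arc_head ;;
       Store tails (Var edge) (Var arc_tail) ;; Store heads (Var edge) (Var arc_head) ;;
       position ::= Var edge \<oplus> Var num_edges ;;
       Store tails (Var position) (Var arc_head) ;; Store heads (Var position) (Var arc_tail))"

lemma mod_copy [simp]:
  "mod_vars copy = {edge, position, arc_tail, arc_head, flag, temp}"
  "mod_arrays copy = {tails, heads}"
  by (auto simp: copy_def)

definition doubled :: "(nat \<times> nat) list \<Rightarrow> (nat \<times> nat) list" where
  "doubled es = rev (es @ map prod.swap es)"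

lemma arc_list_doubled:
  assumes "\<And>e. e < m \<Longrightarrow> stored_arc a e = g e \<and> stored_arc a (e + m) = prod.swap (g e)"
  shows "arc_list (2 * m) a = doubled (map g [0..<m])"
proof -
  have "map (stored_arc a) [0..<2 * m] = map g [0..<m] @ map (prod.swap \<circ> g) [0..<m]"
  proof (rule nth_equalityI)
    fix i assume "i < length (map (stored_arc a) [0..<2 * m])"
    then show "map (stored_arc a) [0..<2 * m] ! i =
        (map g [0..<m] @ map (prod.swap \<circ> g) [0..<m]) ! i"
      using assms[of i] assms[of "i - m"] by (cases "i < m") (auto simp: nth_append)
  qed simp
  then show ?thesis by (simp add: arc_list_def doubled_def flip: rev_map)
qed

lemma wp_copy:
  assumes Z: "v input_end = Z" "2 * m + 4 \<le> Z" and m: "v num_edges = m"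
    and Q: "\<And>v' a' t'. arc_list (2 * m) a' = doubled (map (input_edge f) [0..<m]) \<Longrightarrow>
      frame copy v a v' a' \<Longrightarrow> t' \<le> t + 14 + m * 196 \<Longrightarrow> Q v' a' t'"
  shows "wp (moved_input Z f) copy Q v a t"
  unfolding copy_def
proof (rule wp_For[where K = 182 and I = "\<lambda>j v' a'. \<forall>e<m. j \<le> e \<longrightarrow>
      stored_arc a' e = input_edge f e \<and> stored_arc a' (e + m) = prod.swap (input_edge f e)"],
    goal_cases fresh init step stable exit)
  case init
  then show ?case using m by simp
next
  case (step j v' a' t')
  have regs: "v' input_end = Z" "v' num_edges = m" "v' edge = j" and j: "j < m"
    using step Z m by (auto simp: frame_def)
  show ?case
    unfolding wp_Seq wp_Assign
  proof (rule wp_fetch[where i = "4 + 2 * j"], goal_cases input_end position lower upper tail)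
    case (tail v_tail t_tail)
    then have regs': "v_tail input_end = Z" "v_tail num_edges = m" "v_tail edge = j"
      "v_tail position = 4 + 2 * j"
      using regs by (simp_all add: frame_def)
    show ?case
    proof (rule wp_fetch[where i = "5 + 2 * j"], goal_cases input_end position lower upper head)
      case (head v_head t_head)
      then have "v_head num_edges = m" "v_head edge = j"
        "input_edge f j = (v_head arc_tail, v_head arc_head)"
        using regs' tail(1) by (simp_all add: frame_def input_edge_def)
      then show ?case
        using step(4) j tail(3) head(3) by (auto simp: stored_arc_def le_Suc_eq)
    qed (use regs' Z(2) j in simp_all)
  qed (use regs Z(2) j in simp_all)
next
  case (exit v' a' t')
  then show ?case using m by (intro Q arc_list_doubled) (auto simp: copy_def)
qed auto

section \<open>The main program\<close>

abbreviation (input) result :: nat where "result \<equiv> 0"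

definition compute_sizes :: com where
  "compute_sizes =
     temp ::= Var max_degree \<oplus> Var max_degree ;; temp ::= Var temp \<oplus> Var temp ;;
     temp ::= Var temp \<oplus> Var temp ;; temp ::= Var temp \<oplus> Var temp ;;
     temp ::= Var temp \<oplus> Var temp ;; temp ::= Var temp \<oplus> Var temp ;;
     num_arcs ::= Var num_edges \<oplus> Var num_edges ;;
     num_vertices ::= Var input_end \<ominus> Var temp ;; num_vertices ::= Var num_vertices \<ominus> Var num_arcs"

definition compute_bounds :: com where
  "compute_bounds =
     num_guesses ::= Atom (Num 1) ;; budget ::= Atom (Var num_edges) ;;
     FOR vertex BELOW excess DO (
       num_guesses ::= Var num_guesses \<oplus> Var num_guesses ;;
       num_guesses ::= Var num_guesses \<oplus> Var num_guesses ;;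
       budget ::= Var budget \<oplus> Var max_degree)"

lemma mod_compute_bounds [simp]:
  "mod_vars compute_bounds = {num_guesses, budget, vertex}" "mod_arrays compute_bounds = {}"
  by (auto simp: compute_bounds_def)

lemma wp_compute_bounds:
  assumes Q: "\<And>v' t'. v' num_guesses = 4 ^ v excess \<Longrightarrow>
      v' budget = v num_edges + v excess * v max_degree \<Longrightarrow>
    frame compute_bounds v a v' a \<Longrightarrow> t' \<le> t + 36 + v excess * 47 \<Longrightarrow> Q v' a t'"
  shows "wp w compute_bounds Q v a t"
proof -
  let ?I = "\<lambda>j v' a'. v' num_guesses = 4 ^ (v excess - j) \<and>
    v' budget = v num_edges + (v excess - j) * v max_degree \<and> a' = a"
  have "wp w compute_bounds (\<lambda>v' a' t'. ?I 0 v' a' \<and> t' \<le> t + 36 + v excess * 47) v a t"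
    unfolding compute_bounds_def wp_Seq wp_Assign
  proof (rule wp_For[where I = ?I and K = 33], goal_cases fresh init step stable exit)
    case (step j v' a' t')
    then have "v excess - j = Suc (v excess - Suc j)" "v' max_degree = v max_degree"
      by (auto simp: frame_def)
    then show ?case using step(4) by simp
  qed auto
  then show ?thesis by (rule wp_conseq) (simp add: Q)
qed

definition decide :: com where
  "decide =
     answer ::= Atom (Num 1) ;; flag ::= Var max_degree \<ominus> Num 1 ;; IF flag THEN search ELSE Skip ;;
     result ::= Atom (Var answer)"

definition accepts :: "nat \<Rightarrow> nat \<Rightarrow> (nat \<times> nat) list \<Rightarrow> bool" where
  "accepts B k es \<longleftrightarrow> B \<le> 1 \<or>
     (\<exists>x<4 ^ k. B * card (branch_cover (set (doubled es)) (doubled es) {} (digit (4 ^ k) x)) \<le>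
         length es + k * B)"

lemma wp_decide:
  assumes loaded: "graph_loaded n (set (doubled es)) v a" "arc_list (v num_arcs) a = doubled es"
    and regs: "v max_degree = B" "v num_guesses = 4 ^ k" "v budget = length es + k * B"
  shows "wp w decide (\<lambda>v' a' t'. v' result = (if accepts B k es then 1 else 0) \<and>
    t' \<le> t + 61 + (if B \<le> 1 then 0 else 4 ^ k * (trial_time n (v num_arcs) + 14))) v a t"
    (is "wp w decide ?Q v a t")
proof (cases "B \<le> 1")
  case True
  then show ?thesis using regs(1) by (simp add: decide_def accepts_def)
next
  case False
  let ?v = "v(answer := 1, flag := B - 1)"
  have loaded': "graph_loaded n (set (doubled es)) ?v a"
    by (rule graph_loaded_cong[OF loaded(1)]) auto
  have regs': "4 ^ k = ?v num_guesses" "doubled es = arc_list (?v num_arcs) a"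
    using regs(2) loaded(2) by simp_all
  have "wp w search (wp w (result ::= Atom (Var answer)) ?Q) ?v a (t + 25)"
  proof (rule wp_search[OF loaded' regs'])
    fix v' :: "nat \<Rightarrow> nat" and a' t'
    assume "v' answer = (if \<exists>x<4 ^ k. ?v max_degree *
        card (branch_cover (set (doubled es)) (doubled es) {} (digit (4 ^ k) x)) \<le> ?v budget
        then 1 else 0)"
      and "t' \<le> t + 25 + 25 + 4 ^ k * (trial_time n (?v num_arcs) + 14)"
    then show "wp w (result ::= Atom (Var answer)) ?Q v' a' t'"
      using False regs by (simp add: accepts_def)
  qed
  then show ?thesis using False regs(1) by (simp add: decide_def add.commute)
qed

definition main :: com where
  "main = compute_sizes ;; copy ;; compute_bounds ;; decide"

lemma wf_main: "wf_com main"
  by (simp add: main_def compute_sizes_def copy_def fetch_def compute_bounds_def decide_def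
      search_def trial_def branch_all_def branch_def extend_cover_def pick_def pick_tail_def pick_head_def
      read_guess_def probe_def relax_def start_auction_def settle_all_def bid_def place_bid_def
      scan_def)

definition main_time :: "nat \<Rightarrow> nat \<Rightarrow> nat \<Rightarrow> nat \<Rightarrow> nat" where
  "main_time B k n m =
     210 + m * 196 + k * 47 + (if B \<le> 1 then 0 else 4 ^ k * (trial_time n (2 * m) + 14))"

lemma wp_main:
  assumes v: "v max_degree = B" "v excess = k" "v input_end = Z" "v num_edges = m" and B: "0 < B"
    and Z: "Z = n + 64 * B + 2 * m" and es: "es = map (input_edge f) [0..<m]"
    and subset: "set (doubled es) \<subseteq> {..<n} \<times> {..<n}"
  shows "wp (moved_input Z f) main (\<lambda>v' a' t'.
    v' result = (if accepts B k es then 1 else 0) \<and> t' \<le> t + main_time B k n m) v a t"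
    (is "wp ?w main ?Q v a t")
proof -
  let ?v = "v(temp := 64 * B, num_arcs := 2 * m, num_vertices := n)"
  have "wp ?w copy (wp ?w compute_bounds (wp ?w decide ?Q)) ?v a (t + 99)"
  proof (rule wp_copy)
    fix v' a' t'
    assume arcs: "arc_list (2 * m) a' = doubled (map (input_edge f) [0..<m])"
      and frame: "frame copy ?v a v' a'" and time: "t' \<le> t + 99 + 14 + m * 196"
    have "set (doubled es) = stored_arc a' ` {..<2 * m}"
      using arg_cong[OF arcs, of set] es by (simp add: arc_list_def lessThan_atLeast0)
    then have loaded: "graph_loaded n (set (doubled es)) v' a'"
      using subset frame by (simp add: graph_loaded_def frame_def)
    show "wp ?w compute_bounds (wp ?w decide ?Q) v' a' t'"
    proof (rule wp_compute_bounds)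
      fix v'' t''
      assume bounds: "v'' num_guesses = 4 ^ v' excess"
        "v'' budget = v' num_edges + v' excess * v' max_degree"
        and frame': "frame compute_bounds v' a' v'' a'" and time': "t'' \<le> t' + 36 + v' excess * 47"
      have "graph_loaded n (set (doubled es)) v'' a'"
        by (rule graph_loaded_cong[OF loaded]) (use frame' in \<open>auto simp: frame_def\<close>)
      then show "wp ?w decide ?Q v'' a' t''"
        by (rule wp_conseq[OF wp_decide])
           (use arcs es bounds frame frame' v time time' in \<open>auto simp: frame_def main_time_def\<close>)
    qed
  qed (use v B Z in simp_all)
  then show ?thesis using v Z by (simp add: main_def compute_sizes_def add.commute flip: mult_2)
qed

section \<open>Freeing the registers\<close>

text \<open>Initially no register is free.  Adding \<open>64 B + 2 m\<close> to the register that holds \<open>n\<close> yields an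
  address \<open>Z\<close> beyond both the input and the registers without losing information.  Register 3 then
  serves as the constant 1.\<close>

definition save_code :: "nat list \<Rightarrow> instr list" where
  "save_code rs = concat (map (\<lambda>r. [Add 2 2 3, StoreI 2 r]) rs)"

definition saved_registers :: "nat list" where
  "saved_registers = [4..<43]"

lemma saved_registers_simps [simp]:
  "length saved_registers = 39" "set saved_registers = {4..<43}"
  "j < 39 \<Longrightarrow> saved_registers ! j = 4 + j"
  by (simp_all add: saved_registers_def nth_upt del: upt_rec_numeral)

definition prologue :: "instr list" where
  "prologue = replicate 64 (Add 2 2 0) @ replicate 2 (Add 2 2 3) @ [StoreI 2 3, LoadC 3 1] @
     save_code saved_registers @ [Add base 2 3, LoadC 4 39, Sub 2 2 4, LoadI 3 2]"

lemma length_prologue: "length prologue = 150"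
proof -
  have "length (save_code rs) = 2 * length rs" for rs
    by (induction rs) (simp_all add: save_code_def)
  then show ?thesis by (simp add: prologue_def)
qed

lemma jump_free_prologue: "jump_free prologue"
  by (auto simp: prologue_def save_code_def jump_free_def)

lemma effect_repeated_Add:
  "x \<noteq> y \<Longrightarrow> (effect (Add x x y) ^^ j) m = m(x := m x + j * m y)"
  by (induction j) auto

lemma effect_save_code:
  assumes "m 2 = z" "m 3 = 1" "3 < z" "\<forall>r\<in>set rs. r < z \<and> r \<noteq> 2"
  shows "fold effect (save_code rs) m =
    (\<lambda>q. if q = 2 then z + length rs
         else if z < q \<and> q \<le> z + length rs then m (rs ! (q - Suc z)) else m q)"
  using assms(4)
proof (induction rs rule: rev_induct)
  case Nil
  then show ?case using assms(1) by (auto simp: save_code_def)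
next
  case (snoc r rs)
  then show ?case using assms(2,3) by (auto simp: save_code_def nth_append fun_eq_iff)
qed

lemma effect_prologue:
  assumes Z: "Z = m 2 + 64 * m 0 + 2 * m 3" "43 \<le> Z"
  defines "m' \<equiv> fold effect prologue m"
  shows "m' 0 = m 0" "m' 1 = m 1" "m' 2 = Z" "m' 3 = m 3" "m' base = Z + 40"
    and "43 \<le> q \<Longrightarrow> q < Z \<Longrightarrow> m' q = m q"
    and "i < 40 \<Longrightarrow> m' (Z + i) = m (i + 3)"
proof -
  let ?entered = "m(2 := Z, Z := m 3, 3 := 1)"
  let ?saved = "\<lambda>q. if q = 2 then Z + 39
    else if Z < q \<and> q \<le> Z + 39 then ?entered (saved_registers ! (q - Suc Z)) else ?entered q"
  let ?enter = "replicate 64 (Add 2 2 0) @ replicate 2 (Add 2 2 3) @ [StoreI 2 3, LoadC 3 1]"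
  let ?leave = "[Add base 2 3, LoadC 4 39, Sub 2 2 4, LoadI 3 2]"
  have enter: "fold effect ?enter m = ?entered"
    using Z(1) by (simp add: effect_repeated_Add)
  have save: "fold effect (save_code saved_registers) ?entered = ?saved"
    using effect_save_code[of ?entered Z saved_registers, unfolded saved_registers_simps(1)] Z(2)
    by simp
  have "m' = fold effect ?leave (fold effect (save_code saved_registers) (fold effect ?enter m))"
    by (simp add: m'_def prologue_def)
  also have "\<dots> = ?saved(base := Z + 40, 4 := 39, 2 := Z, 3 := m 3)"
    unfolding enter save using Z(2) by (simp add: add.commute)
  finally have m': "m' = ?saved(base := Z + 40, 4 := 39, 2 := Z, 3 := m 3)" .
  show "m' 0 = m 0" "m' 1 = m 1" "m' 2 = Z" "m' 3 = m 3" "m' base = Z + 40"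
    "43 \<le> q \<Longrightarrow> q < Z \<Longrightarrow> m' q = m q"
    using Z(2) by (simp_all add: m')
  show "m' (Z + i) = m (i + 3)" if "i < 40"
    using that Z(2) by (cases i) (simp_all add: m')
qed

definition program :: "instr list" where
  "program = prologue @ compile (length prologue) main"

lemma rep_prologue:
  assumes Z: "Z = f 2 + 64 * f 0 + 2 * f 3" "43 \<le> Z"
  defines "m \<equiv> fold effect prologue f"
  shows "rep (moved_input Z f) (m, \<lambda>j i. m (m base + 8 * i + j)) m"
proof -
  note m = effect_prologue[OF Z, folded m_def]
  have "43 \<le> p \<and> p < m base \<and> m p = c" if p: "moved_input Z f p = Some c" for p c
  proof (cases "p < Z")
    case True
    then show ?thesis using p m(5) m(6)[of p] by (auto simp: moved_input_def split: if_splits)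
  next
    case False
    then show ?thesis
      using p Z(2) m(5) m(7)[of "p - Z"] by (auto simp: moved_input_def split: if_splits)
  qed
  then show ?thesis using Z(2) m(5) by (auto simp: rep_def)
qed

lemma program_runs_within:
  assumes f: "f = snd (init xs)" and Z: "Z = f 2 + 64 * f 0 + 2 * f 3" "43 \<le> Z"
    and main: "\<And>v a. v 0 = f 0 \<Longrightarrow> v 1 = f 1 \<Longrightarrow> v 2 = Z \<Longrightarrow> v 3 = f 3 \<Longrightarrow>
      wp (moved_input Z f) main (\<lambda>v' a' t'. v' result = out \<and> t' \<le> T) v a 0"
  shows "runs_within program xs (T + 150) out"
proof -
  let ?m = "fold effect prologue f" and ?main = "compile 150 main"
  let ?a = "\<lambda>j i. ?m (?m base + 8 * i + j)"
  have code: "code_at program 0 prologue" "code_at program 150 ?main"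
    using code_at_suffix[of "[]" program]
    by (simp_all add: program_def code_at_append length_prologue)
  obtain v' a' t' where run: "run (moved_input Z f) main (?m, ?a) t' (v', a')"
    and out: "v' result = out" "t' \<le> T"
    using main[OF effect_prologue(1-4)[OF Z], of ?a] unfolding wp_def by auto
  obtain m' where m': "reach program t' (150, ?m) (150 + length ?main, m')"
    "rep (moved_input Z f) (v', a') m'"
    using compile_correct[OF run wf_main code(2)] rep_prologue[OF Z] unfolding simulates_def
    by blast
  have "init xs = (0, f)" by (simp add: f init_def)
  then have "reach program 150 (init xs) (150, ?m)"
    using reach_jump_free[OF code(1) jump_free_prologue, of f] by (simp add: length_prologue)
  from reach_trans[OF this m'(1)] have "reach program (T + 150) (init xs) (150 + length ?main, m')"
    by (rule reach_mono) (use out(2) in simp)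
  moreover have "m' 0 = out" using rep_varD[OF m'(2), of 0] out(1) by simp
  ultimately show ?thesis
    by (fastforce simp: runs_within_def reach_def halted_def program_def length_prologue)
qed

section \<open>Correctness and running time\<close>

lemma init_encode:
  defines "f \<equiv> \<lambda>B k n es. snd (init (encode B k n es))"
  shows "f B k n es 0 = B" "f B k n es 1 = k" "f B k n es 2 = n" "f B k n es 3 = length es"
    and "map (input_edge (f B k n es)) [0..<length es] = es"
proof -
  have len: "length (concat (map (\<lambda>(u, v). [u, v]) es)) = 2 * length es"
    for es :: "(nat \<times> nat) list"
    by (induction es) auto
  have nth: "i < length es \<Longrightarrow> (concat (map (\<lambda>(u, v). [u, v]) es) ! (2 * i),
      concat (map (\<lambda>(u, v). [u, v]) es) ! Suc (2 * i)) = es ! i" for i and es :: "(nat \<times> nat) list"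
    by (induction es arbitrary: i) (auto simp: nth_Cons split: nat.splits)
  show "f B k n es 0 = B" "f B k n es 1 = k" "f B k n es 2 = n" "f B k n es 3 = length es"
    by (simp_all add: f_def init_def encode_def)
  have "input_edge (f B k n es) i = es ! i" if i: "i < length es" for i
    using nth[OF i] i len[of es]
    by (simp add: input_edge_def f_def init_def encode_def eval_nat_numeral)
  then show "map (input_edge (f B k n es)) [0..<length es] = es"
    by (intro nth_equalityI) auto
qed

lemma set_doubled: "set (doubled es) = set es \<union> prod.swap ` set es"
  by (auto simp: doubled_def)

locale edge_listed_graph =
  fixes n :: nat and E :: "nat set set" and es :: "(nat \<times> nat) list"
  assumes simple: "simple_graph n E" and listed: "edge_list_of es E"
begin

abbreviation arcs :: "(nat \<times> nat) set" where
  "arcs \<equiv> set (doubled es)"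

lemma listed_edge:
  assumes "(u, w) \<in> set es"
  shows "u < n" "w < n" "u \<noteq> w" "{u, w} \<in> E"
proof -
  show "{u, w} \<in> E" using assms listed by (auto simp: edge_list_of_def)
  then obtain x y where "{u, w} = {x, y}" "x \<noteq> y" "x < n" "y < n"
    using simple by (auto simp: simple_graph_def)
  then show "u < n" "w < n" "u \<noteq> w" by (auto simp: doubleton_eq_iff)
qed

lemma arcs_subset: "arcs \<subseteq> {..<n} \<times> {..<n}"
  using listed_edge by (auto simp: set_doubled)

lemma sym_arcs: "sym arcs"
  by (auto simp: set_doubled sym_def)

lemma arc_iff: "(u, w) \<in> arcs \<longleftrightarrow> {u, w} \<in> E"
proof
  assume "(u, w) \<in> arcs"
  then have "(u, w) \<in> set es \<or> (w, u) \<in> set es" by (auto simp: set_doubled)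
  then show "{u, w} \<in> E"
    using listed_edge(4)[of u w] listed_edge(4)[of w u] by (auto simp: insert_commute)
next
  assume "{u, w} \<in> E"
  then obtain x y where "(x, y) \<in> set es" "{u, w} = {x, y}"
    using listed by (force simp: edge_list_of_def)
  then show "(u, w) \<in> arcs" by (force simp: set_doubled doubleton_eq_iff)
qed

lemma card_edges: "card E = length es"
  using listed distinct_card[of "map (\<lambda>(u, v). {u, v}) es"] by (simp add: edge_list_of_def)

lemma card_arcs: "card arcs = 2 * length es"
proof -
  have inj: "inj_on (\<lambda>(u, w). {u, w}) (set es)" and distinct: "distinct es"
    using listed by (auto simp: edge_list_of_def distinct_map)
  have "(w, u) \<notin> set es" if "(u, w) \<in> set es" for u w
    using inj_onD[OF inj, of "(u, w)" "(w, u)"] that listed_edge(3)[OF that] by auto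
  then have "prod.swap ` set es \<inter> set es = {}" by auto
  then have "distinct (doubled es)" using distinct by (simp add: doubled_def distinct_map)
  then have "card arcs = length (doubled es)" by (rule distinct_card)
  also have "\<dots> = 2 * length es" by (simp add: doubled_def)
  finally show ?thesis .
qed

lemma length_edges_le: "2 * length es \<le> n * n"
  using card_mono[OF _ arcs_subset] card_arcs by (simp add: card_cartesian_product)

lemma card_neighbours_le:
  assumes "max_degree_le n E B"
  shows "card (arcs `` {u}) \<le> B"
proof (cases "u < n")
  case True
  have "finite E" using listed by (auto simp: edge_list_of_def)
  then have "card (arcs `` {u}) \<le> degree E u"
    unfolding degree_def
    by (intro card_inj_on_le[of "\<lambda>w. {u, w}"]) (auto simp: inj_on_def doubleton_eq_iff arc_iff)
  then show ?thesis using assms True by (force simp: max_degree_le_def)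
next
  case False
  then have "arcs `` {u} = {}" using arcs_subset by blast
  then show ?thesis by simp
qed

lemma vertex_cover_iff: "vertex_cover n E S \<longleftrightarrow> S \<subseteq> {..<n} \<and> covers arcs S"
proof -
  have "E = (\<lambda>(u, w). {u, w}) ` arcs"
  proof
    show "E \<subseteq> (\<lambda>(u, w). {u, w}) ` arcs"
    proof
      fix e assume e: "e \<in> E"
      then obtain u w where uw: "e = {u, w}" using simple by (auto simp: simple_graph_def)
      then show "e \<in> (\<lambda>(u, w). {u, w}) ` arcs"
        using e arc_iff by (intro image_eqI[of _ _ "(u, w)"]) auto
    qed
  qed (auto simp: arc_iff)
  then have "(\<forall>e\<in>E. e \<inter> S \<noteq> {}) \<longleftrightarrow> (\<forall>(u, w)\<in>arcs. u \<in> S \<or> w \<in> S)" by auto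
  then show ?thesis
    using finite_subset[of S "{..<n}"] by (auto simp: vertex_cover_def covers_def)
qed

lemma VCL1_iff:
  assumes "0 < B"
  shows "VCL1 B k n E \<longleftrightarrow> (\<exists>S\<subseteq>{..<n}. covers arcs S \<and> B * card S \<le> length es + k * B)"
proof -
  have "real s \<le> real (card E) / real B + real k \<longleftrightarrow> B * s \<le> length es + k * B" for s
  proof -
    have "real s \<le> real (card E) / real B + real k \<longleftrightarrow> real (B * s) \<le> real (length es + k * B)"
      using assms by (simp add: field_simps card_edges)
    then show ?thesis by (simp only: of_nat_le_iff)
  qed
  then show ?thesis by (auto simp: VCL1_def vertex_cover_iff)
qed

lemma accepts_if_VCL1:
  assumes B: "0 < B" and deg: "max_degree_le n E B" and "VCL1 B k n E"
  shows "accepts B k es"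
proof -
  obtain S where S: "covers arcs S" "B * card S \<le> length es + k * B"
    using assms(3) VCL1_iff[OF B] by blast
  have "arcs\<inverse> = arcs" using sym_arcs by (simp add: sym_conv_converse_eq)
  then have "card arcs \<le> B * bicover_number arcs"
    by (intro card_le_degree_bicover_number) (simp_all add: card_neighbours_le[OF deg])
  then have "B * (2 * card S) \<le> B * (2 * k + double_lp arcs {})"
    using S(2) card_arcs by (simp add: double_lp_def algebra_simps)
  then have "extends_within arcs (2 * k) {} S" using B S(1) by (simp add: extends_within_def)
  then obtain g where g: "\<forall>i\<ge>2 * k. \<not> g i" "card (branch_cover arcs (doubled es) {} g) \<le> card S"
    using branch_cover_optimal[OF _ sym_arcs] by blast
  then obtain x where "x < 4 ^ k" "digit (4 ^ k) x = g"
    using digit_surj[of "2 * k" g] by (auto simp: power_mult)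
  moreover have "B * card (branch_cover arcs (doubled es) {} g) \<le> length es + k * B"
    using mult_le_mono2[OF g(2)] S(2) by (rule le_trans)
  ultimately show ?thesis by (auto simp: accepts_def)
qed

lemma VCL1_if_accepts:
  assumes B: "0 < B" and "accepts B k es"
  shows "VCL1 B k n E"
proof -
  consider (matching) "B = 1"
    | (accepted) x where "B * card (branch_cover arcs (doubled es) {} (digit (4 ^ k) x)) \<le>
        length es + k * B"
    using assms by (force simp: accepts_def)
  then show ?thesis
  proof cases
    case matching
    have "covers arcs (fst ` set es)" "fst ` set es \<subseteq> {..<n}"
      using listed_edge(1) by (auto simp: covers_def set_doubled intro: rev_image_eqI)
    moreover have "card (fst ` set es) \<le> length es"
      using card_image_le[of "set es" fst] card_length[of es] by simp
    ultimately show ?thesis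
      unfolding VCL1_iff[OF B] by (intro exI[of _ "fst ` set es"]) (simp add: matching)
  next
    case accepted
    have "covers arcs (branch_cover arcs (doubled es) {} (digit (4 ^ k) x))"
      by (rule covers_branch_cover) simp
    moreover have "branch_cover arcs (doubled es) {} (digit (4 ^ k) x) \<subseteq> {..<n}"
      using branch_cover_subset[of "{}" arcs "doubled es" "digit (4 ^ k) x"] arcs_subset
      by fastforce
    ultimately show ?thesis unfolding VCL1_iff[OF B] using accepted by blast
  qed
qed

lemma program_decides:
  assumes B: "0 < B"
  shows "runs_within program (encode B k n es) (main_time B k n (length es) + 150)
    (if accepts B k es then 1 else 0)"
proof -
  define f where "f = snd (init (encode B k n es))"
  let ?Z = "n + 64 * B + 2 * length es"
  have f: "f 0 = B" "f 1 = k" "f 2 = n" "f 3 = length es" "map (input_edge f) [0..<length es] = es"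
    unfolding f_def by (rule init_encode)+
  have "wp (moved_input ?Z f) main (\<lambda>v' a' t'.
      v' result = (if accepts B k es then 1 else 0) \<and> t' \<le> 0 + main_time B k n (length es)) v a 0"
    if "v 0 = f 0" "v 1 = f 1" "v 2 = ?Z" "v 3 = f 3" for v a
    using that f B arcs_subset by (intro wp_main) simp_all
  then show ?thesis
    by (intro program_runs_within[OF f_def, of ?Z]) (use B f in simp_all)
qed

end

lemma trial_time_le:
  assumes "m \<le> n * n"
  shows "trial_time n m \<le> 1534 * (n + 1) ^ 7"
proof -
  define X where "X = n + 1"
  have ge1: "1 \<le> X ^ j" for j by (simp add: X_def)
  have nX: "n \<le> X" "n * n + 1 \<le> X ^ 2" and mX: "m \<le> X ^ 2"
    using assms by (simp_all add: X_def power2_eq_square)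
  have "(130 * m + 111) * (n * n + 1) \<le> (241 * X ^ 2) * X ^ 2"
    by (intro mult_mono nX(2)) (use mX ge1[of 2] in auto)
  also have "\<dots> = 241 * X ^ 4" by (simp flip: power_add)
  also have "(130 * m + 111) * (n * n + 1) = bids_time n m - 3"
    by (simp add: bids_time_def bid_time_def scan_time_def algebra_simps)
  finally have "bids_time n m \<le> 244 * X ^ 4" using ge1[of 4] by linarith
  then have "n * (bids_time n m + 89) \<le> X * (333 * X ^ 4)"
    by (intro mult_mono nX) (use ge1[of 4] in auto)
  also have "\<dots> = 333 * X ^ 5" by (simp add: mult.left_commute flip: power_Suc)
  finally have "branch_time n m + 14 \<le> 1434 * X ^ 5"
    using ge1[of 5] by (simp add: branch_time_def relax_time_def)
  then have "m * (branch_time n m + 14) \<le> X ^ 2 * (1434 * X ^ 5)" by (intro mult_mono mX) auto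
  also have "\<dots> = 1434 * X ^ 7" by (simp flip: power_add)
  finally have "trial_time n m \<le> 75 + 25 * X ^ 1 + 1434 * X ^ 7"
    using nX by (simp add: trial_time_def)
  moreover have "X ^ 1 \<le> X ^ 7" by (intro power_increasing) (simp_all add: X_def)
  ultimately show ?thesis using ge1[of 7] unfolding X_def by linarith
qed

lemma main_time_le:
  assumes B: "0 < B" and m: "2 * m \<le> n * n"
  shows "main_time B k n m + 150 \<le> 2151 * 2 ^ (k * B) * (n + 1) ^ 7"
proof -
  define X where "X = (n + 1) ^ 7"
  define K where "K = (2::nat) ^ (k * B)"
  have ge1: "1 \<le> X" "1 \<le> K" by (simp_all add: X_def K_def)
  have "n * n \<le> (n + 1) ^ 2" by (simp add: power2_eq_square)
  also have "\<dots> \<le> X" unfolding X_def by (rule power_increasing) auto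
  finally have mX: "m \<le> X" using m by linarith
  have "k < 2 ^ k" by (rule less_exp)
  also have "(2::nat) ^ k \<le> K" unfolding K_def using B by (intro power_increasing) auto
  finally have kK: "k \<le> K" by simp
  have "(if B \<le> 1 then 0 else 4 ^ k * (trial_time n (2 * m) + 14)) \<le> K * (1548 * X)"
  proof (cases "B \<le> 1")
    case False
    have "(4::nat) ^ k = 2 ^ (2 * k)" by (simp add: power_mult)
    also have "\<dots> \<le> K" unfolding K_def using False by (intro power_increasing) auto
    finally have "4 ^ k \<le> K" .
    moreover have "trial_time n (2 * m) + 14 \<le> 1548 * X"
      using trial_time_le[OF m] ge1(1) unfolding X_def by linarith
    ultimately show ?thesis using False mult_le_mono by simp
  qed simp
  then have "main_time B k n m + 150 \<le> 360 + m * 196 + k * 47 + 1548 * (K * X)"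
    by (simp add: main_time_def)
  moreover have "1 \<le> K * X" "X \<le> K * X" "K \<le> K * X" using ge1 by simp_all
  ultimately have "main_time B k n m + 150 \<le> 2151 * (K * X)" using mX kK by linarith
  then show ?thesis by (simp add: K_def X_def mult.assoc)
qed

lemma runs_within_mono: "runs_within P xs S out \<Longrightarrow> S \<le> T \<Longrightarrow> runs_within P xs T out"
  unfolding runs_within_def using le_trans by blast

theorem theorem3:
  "\<exists>(P :: instr list) (c :: nat) (d :: nat).
     \<forall>B k n E es.
       B > 0 \<longrightarrow> k > 0 \<longrightarrow> simple_graph n E \<longrightarrow> max_degree_le n E B \<longrightarrow>
       edge_list_of es E \<longrightarrow>
       runs_within P (encode B k n es) (c * 2 ^ (k * B) * (n + 1) ^ d)
         (if VCL1 B k n E then 1 else 0)"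
proof (intro exI allI impI)
  fix B k n :: nat and E es
  assume B: "B > 0" and "simple_graph n E" "edge_list_of es E" and deg: "max_degree_le n E B"
  then interpret edge_listed_graph n E es by unfold_locales
  have "runs_within program (encode B k n es) (2151 * 2 ^ (k * B) * (n + 1) ^ 7)
      (if accepts B k es then 1 else 0)"
    using program_decides[OF B] main_time_le[OF B length_edges_le] by (rule runs_within_mono)
  moreover have "accepts B k es \<longleftrightarrow> VCL1 B k n E"
    using accepts_if_VCL1[OF B deg] VCL1_if_accepts[OF B] by blast
  ultimately show "runs_within program (encode B k n es) (2151 * 2 ^ (k * B) * (n + 1) ^ 7)
      (if VCL1 B k n E then 1 else 0)"
    by simp
qed

end
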